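(* Let $p$ be a fixed point on a complex manifold $M$, let $s\ge 1$, and let $\chi_1,\dots,\chi_s\in\mathcal{O}_p$ be non-constant germs of holomorphic functions at $p$ such that $\chi_1(p)=\cdots=\chi_s(p)=0$. Let $r_1,\dots,r_s$ be non-zero real numbers. Then the following statements hold: (i) $\log\left(1+\sum_{i=1}^s r_i|\chi_i|^2\right)\notin K_p\setminus\mathbb{R}_p$; (ii) $\exp\left(\sum_{i=1}^s r_i|\chi_i|^2\right)\notin K_p\setminus\mathbb{R}_p$; (iii) for every real number $\alpha$, if $\left(1+\sum_{i=1}^s r_i|\chi_i|^2\right)^{\alpha}\in K_p\setminus\mathbb{R}_p$, then $\alpha\in\mathbb{Q}$.
   Context: For a point $p$ of a complex manifold $M$, $\mathcal{O}_p$ denotes the local ring of germs of holomorphic functions at $p$. Define $$\wedge_p:=\left\{ f : f=\sum_{i=1}^{n} r_i|\chi_i|^2,\ \chi_i\in\mathcal{O}_p,\ r_i\in\mathbb{R}\right\}$$ ($n$ is an arbitrary positive integer, and here the $\chi_i$ need not vanish at $p$). This is a subring of the integral domain of germs at $p$ of real-valued real-analytic functions. $K_p$ denotes the field of fractions of $\wedge_p$, and $\mathbb{R}_p\subset K_p$ denotes the germs at $p$ of real constant functions. A germ $\phi$ of a real-analytic function at $p$ belongs to $K_p$ if there are $u,v\in\wedge_p$ with $v\neq 0$ and $v\phi=u$ as germs at $p$. Since $1+\sum_i r_i|\chi_i|^2$ equals $1$ at $p$, it is positive near $p$, so its logarithm and its real powers are well-defined germs of real-analytic functions at $p$. *)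

theory Defs
  imports "HOL-Analysis.Analysis"
begin

definition holomorphic_vec_on :: "(complex ^ 'n \<Rightarrow> complex) \<Rightarrow> (complex ^ 'n) set \<Rightarrow> bool" where
  "holomorphic_vec_on f S \<longleftrightarrow>
     (\<forall>z\<in>S. \<exists>D. (f has_derivative D) (at z) \<and> (\<forall>c v. D (c *s v) = c * D v))"

text \<open>Local expansion as an (unordered, hence absolutely convergent) multivariate power series
  in the real coordinates; the multi-indices are the functions from the basis to the naturals.\<close>

definition real_analytic_at :: "('e::euclidean_space \<Rightarrow> real) \<Rightarrow> 'e \<Rightarrow> bool" where
  "real_analytic_at f a \<longleftrightarrow>
     (\<exists>c. \<forall>\<^sub>F x in nhds a.
        ((\<lambda>m. c m * (\<Prod>b\<in>Basis. ((x - a) \<bullet> b) ^ m b)) has_sum f x) (Basis \<rightarrow>\<^sub>E UNIV))"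

text \<open>A complex manifold with underlying space \<open>M\<close>, given by a holomorphic atlas \<open>A\<close> (not necessarily
  maximal) of charts \<open>(U, \<phi>)\<close>; the values of \<open>\<phi>\<close> outside \<open>U\<close> are irrelevant.\<close>

locale complex_manifold =
  fixes M :: "'a topology" and A :: "('a set \<times> ('a \<Rightarrow> complex ^ 'n)) set"
  assumes Hausdorff: "Hausdorff_space M"
    and second_countable: "second_countable M"
    and cover: "(\<Union>(U, \<phi>)\<in>A. U) = topspace M"
    and chart_dom: "(U, \<phi>) \<in> A \<Longrightarrow> openin M U"
    and chart_img: "(U, \<phi>) \<in> A \<Longrightarrow> open (\<phi> ` U)"
    and chart_homeo:
      "(U, \<phi>) \<in> A \<Longrightarrow> homeomorphic_map (subtopology M U) (top_of_set (\<phi> ` U)) \<phi>"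
    and compatible:
      "(U, \<phi>) \<in> A \<Longrightarrow> (V, \<psi>) \<in> A \<Longrightarrow>
         holomorphic_vec_on (\<lambda>z. \<psi> (inv_into U \<phi> z) $ j) (\<phi> ` (U \<inter> V))"

definition holomorphic_near ::
    "'a topology \<Rightarrow> ('a set \<times> ('a \<Rightarrow> complex ^ 'n)) set \<Rightarrow> 'a \<Rightarrow> ('a \<Rightarrow> complex) \<Rightarrow> bool" where
  "holomorphic_near M A p f \<longleftrightarrow>
     (\<exists>W. openin M W \<and> p \<in> W \<and>
        (\<forall>(U, \<phi>)\<in>A. holomorphic_vec_on (f \<circ> inv_into U \<phi>) (\<phi> ` (U \<inter> W))))"

definition real_analytic_near ::
    "'a topology \<Rightarrow> ('a set \<times> ('a \<Rightarrow> complex ^ 'n)) set \<Rightarrow> 'a \<Rightarrow> ('a \<Rightarrow> real) \<Rightarrow> bool" where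
  "real_analytic_near M A p f \<longleftrightarrow>
     (\<forall>(U, \<phi>)\<in>A. p \<in> U \<longrightarrow> real_analytic_at (f \<circ> inv_into U \<phi>) (\<phi> p))"

text \<open>The germ of \<open>f\<close> at \<open>p\<close>, as the class of all functions agreeing with \<open>f\<close> near \<open>p\<close>. Functions are
  total on the ambient type, but only their values close to \<open>p\<close> in \<open>M\<close> matter.\<close>

definition germ :: "'a topology \<Rightarrow> 'a \<Rightarrow> ('a \<Rightarrow> 'b) \<Rightarrow> ('a \<Rightarrow> 'b) set" where
  "germ M p f = {g. \<forall>\<^sub>F x in nhdsin M p. g x = f x}"

lemma germ_eq_iff: "germ M p f = germ M p g \<longleftrightarrow> (\<forall>\<^sub>F x in nhdsin M p. f x = g x)"
proof
  assume "germ M p f = germ M p g"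
  moreover have "f \<in> germ M p f" by (simp add: germ_def)
  ultimately show "\<forall>\<^sub>F x in nhdsin M p. f x = g x" by (simp add: germ_def)
next
  assume *: "\<forall>\<^sub>F x in nhdsin M p. f x = g x"
  have "(\<forall>\<^sub>F x in nhdsin M p. h x = f x) \<longleftrightarrow> (\<forall>\<^sub>F x in nhdsin M p. h x = g x)" for h
    using * by (intro eventually_subst) (auto elim: eventually_mono)
  then show "germ M p f = germ M p g" by (simp add: germ_def)
qed

definition holomorphic_germs ::
    "'a topology \<Rightarrow> ('a set \<times> ('a \<Rightarrow> complex ^ 'n)) set \<Rightarrow> 'a \<Rightarrow> ('a \<Rightarrow> complex) set set" where
  "holomorphic_germs M A p = {germ M p f | f. holomorphic_near M A p f}"

definition constant_germs :: "'a topology \<Rightarrow> 'a \<Rightarrow> ('a \<Rightarrow> 'b) set set" where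
  "constant_germs M p = {germ M p (\<lambda>_. c) | c. True}"

text \<open>The ring \<open>\<and>\<^sub>p\<close>.\<close>

definition wedge_ring ::
    "'a topology \<Rightarrow> ('a set \<times> ('a \<Rightarrow> complex ^ 'n)) set \<Rightarrow> 'a \<Rightarrow> ('a \<Rightarrow> real) set set" where
  "wedge_ring M A p =
     {germ M p (\<lambda>x. \<Sum>i=1..n. r i * (cmod (h i x))\<^sup>2) | (n::nat) r h.
        n \<ge> 1 \<and> (\<forall>i\<in>{1..n}. germ M p (h i) \<in> holomorphic_germs M A p)}"

text \<open>The real-analytic germs in the field of fractions of \<open>\<and>\<^sub>p\<close>: the solutions \<open>f\<close> of
  \<open>v f = u\<close> with \<open>u, v \<in> \<and>\<^sub>p\<close> and \<open>v \<noteq> 0\<close>. Fractions that are not represented by a real-analytic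
  germ are not recorded, since only membership of such germs is ever at issue.\<close>

definition fraction_germs ::
    "'a topology \<Rightarrow> ('a set \<times> ('a \<Rightarrow> complex ^ 'n)) set \<Rightarrow> 'a \<Rightarrow> ('a \<Rightarrow> real) set set" where
  "fraction_germs M A p =
     {germ M p f | f. real_analytic_near M A p f \<and>
        (\<exists>u v. germ M p u \<in> wedge_ring M A p \<and> germ M p v \<in> wedge_ring M A p \<and>
           germ M p v \<noteq> germ M p (\<lambda>_. 0) \<and> germ M p (\<lambda>x. v x * f x) = germ M p u)}"

end

theory Submission
  imports Defs "HOL-Complex_Analysis.Complex_Analysis"
    "HOL-Computational_Algebra.Fundamental_Theorem_Algebra" "HOL-Library.Function_Algebras"
begin

text \<open>Restrict to a complex line through \<open>p\<close> and polarize: with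
  \<open>P(z,w) = \<Sum> r h(z) cnj (h (cnj w))\<close> one gets \<open>V(z,w) E(P(z,w)) = U(z,w)\<close>, where \<open>E\<close> is
  \<open>ln (1 + _)\<close>, \<open>exp\<close> or a power of \<open>1 + _\<close>, and \<open>P\<close>, \<open>U\<close>, \<open>V\<close> are finite sums of products of a
  function of \<open>z\<close> and a function of \<open>w\<close>. Differentiating in \<open>z\<close> gives a polynomial identity between
  \<open>P\<close>, \<open>U\<close>, \<open>V\<close> and their \<open>z\<close>-derivatives. For fixed \<open>z\<close> it holds in the algebra generated by the
  functions of \<open>w\<close> involved, so every homomorphism of this algebra to the complex numbers specializes
  it to a differential equation for functions of \<open>z\<close> alone. As the algebra has countable dimension,
  the argument for the Nullstellensatz provides homomorphisms with arbitrarily large values at a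
  nonconstant element; hence \<open>P\<close> has arbitrarily large specializations, all vanishing at \<open>z = 0\<close>.

  For \<open>exp\<close>, normalizing the equation and letting the size tend to infinity gives a contradiction.
  In the other two cases some specialization of \<open>1 + P\<close> has a zero by Hurwitz's theorem, and
  comparing the orders of both sides of the equation there excludes the logarithm and shows that
  the exponent of the power is rational.\<close>

section \<open>Homomorphisms of countably generated function algebras\<close>

text \<open>The obstacle is that \<open>E\<close> is transcendental and that the kernels are
  defined, and small, only near the origin: evaluation at points \<open>w\<close> keeps
  \<open>norm P < 1\<close>, where \<open>1 + P\<close> has no zero. A homomorphism need not be
  evaluation at a point, so it can make \<open>P\<close> large, but it respects only polynomial
  relations. All three functions satisfy \<open>(a + b * t) * E'(t) = c + d * E(t)\<close>, with
  \<open>(a, b, c, d)\<close> equal to \<open>(1, 1, 1, 0)\<close> for the logarithm,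
  \<open>(1, 0, 0, 1)\<close> for \<open>exp\<close> and \<open>(1, 1, 0, \<alpha>)\<close> for the
  power; together with \<open>U = V * E(P)\<close> this eliminates \<open>E\<close>. A homomorphism
  could also send \<open>U\<close> or \<open>V\<close> to zero and make the equation empty. To
  prevent this, the functions of \<open>z\<close> are taken linearly independent, and the inverses
  of one coefficient function of \<open>U\<close> and one of \<open>V\<close> are adjoined to the
  algebra, so that these coefficients stay nonzero.\<close>

definition fun_scale :: "complex \<Rightarrow> ('w \<Rightarrow> complex) \<Rightarrow> 'w \<Rightarrow> complex" where
  "fun_scale c f = (\<lambda>w. c * f w)"

lemma fun_scale_apply [simp]: "fun_scale c f w = c * f w"
  by (simp add: fun_scale_def)

interpretation fun_space: vector_space fun_scale
  by unfold_locales (auto simp: fun_eq_iff algebra_simps)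

lemma sum_fun_apply: "(\<Sum>i\<in>I. f i) w = (\<Sum>i\<in>I. f i w)"
  by (induction I rule: infinite_finite_induct) auto

lemma prod_fun_apply: "(\<Prod>i\<in>I. f i) w = (\<Prod>i\<in>I. f i w)"
  by (induction I rule: infinite_finite_induct) auto

text \<open>Finite words over a countable set are countable, so spanning by monomials makes the
  countable dimension visible; the empty word gives the constants.\<close>

definition generated_algebra :: "('w \<Rightarrow> complex) set \<Rightarrow> ('w \<Rightarrow> complex) set" where
  "generated_algebra G = fun_space.span (prod_list ` lists G)"

lemma generated_algebra_add:
  "x \<in> generated_algebra G \<Longrightarrow> y \<in> generated_algebra G \<Longrightarrow> x + y \<in> generated_algebra G"
  unfolding generated_algebra_def by (rule fun_space.span_add)

lemma generated_algebra_const: "(\<lambda>_. c) \<in> generated_algebra G"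
proof -
  have "prod_list [] \<in> generated_algebra G"
    unfolding generated_algebra_def by (intro fun_space.span_base imageI) simp
  then have "fun_scale c (prod_list []) \<in> generated_algebra G"
    unfolding generated_algebra_def by (rule fun_space.span_scale)
  then show ?thesis by (simp add: fun_scale_def)
qed

lemma generated_algebra_gen: "g \<in> G \<Longrightarrow> g \<in> generated_algebra G"
proof -
  assume "g \<in> G"
  then have "prod_list [g] \<in> prod_list ` lists G" by (intro imageI) simp
  then show ?thesis unfolding generated_algebra_def by (intro fun_space.span_base) simp
qed

lemma generated_algebra_mult:
  assumes x: "x \<in> generated_algebra G" and y: "y \<in> generated_algebra G"
  shows "x * y \<in> generated_algebra G"
proof -
  have 1: "m * y \<in> generated_algebra G" if m: "m \<in> prod_list ` lists G" for m
    using y unfolding generated_algebra_def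
  proof (induction rule: fun_space.span_induct_alt)
    case base
    show ?case by (simp only: mult_zero_left mult_zero_right fun_space.span_zero)
  next
    case (step c n y)
    obtain l where l: "l \<in> lists G" "m = prod_list l" using m by blast
    obtain l' where l': "l' \<in> lists G" "n = prod_list l'" using step by blast
    have "m * n = prod_list (l @ l')" by (simp add: l l')
    moreover have "prod_list (l @ l') \<in> prod_list ` lists G" using l l' by (intro imageI) simp
    ultimately have "m * n \<in> fun_space.span (prod_list ` lists G)"
      by (simp only: fun_space.span_base)
    then have "fun_scale c (m * n) + m * y \<in> fun_space.span (prod_list ` lists G)"
      using step by (intro fun_space.span_add fun_space.span_scale)
    moreover have "fun_scale c (m * n) + m * y = m * (fun_scale c n + y)"
      by (auto simp: fun_eq_iff algebra_simps)
    ultimately show ?case by (simp only:)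
  qed
  show ?thesis
    using x unfolding generated_algebra_def
  proof (induction rule: fun_space.span_induct_alt)
    case base
    show ?case by (simp only: mult_zero_left mult_zero_right fun_space.span_zero)
  next
    case (step c n x)
    have "fun_scale c (n * y) + x * y \<in> fun_space.span (prod_list ` lists G)"
      using step 1[OF step(1)] unfolding generated_algebra_def
      by (intro fun_space.span_add fun_space.span_scale)
    moreover have "fun_scale c (n * y) + x * y = (fun_scale c n + x) * y"
      by (auto simp: fun_eq_iff algebra_simps)
    ultimately show ?case by (simp only:)
  qed
qed

lemma generated_algebra_sum:
  "(\<And>i. i \<in> I \<Longrightarrow> f i \<in> generated_algebra G) \<Longrightarrow> (\<Sum>i\<in>I. f i) \<in> generated_algebra G"
  unfolding generated_algebra_def by (rule fun_space.span_sum)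

lemma generated_algebra_prod:
  "(\<And>i. i \<in> I \<Longrightarrow> f i \<in> generated_algebra G) \<Longrightarrow> (\<Prod>i\<in>I. f i) \<in> generated_algebra G"
proof (induction I rule: infinite_finite_induct)
  case (insert x F)
  then have "f x \<in> generated_algebra G" "prod f F \<in> generated_algebra G" by blast+
  then show ?case unfolding prod.insert[OF insert.hyps] by (rule generated_algebra_mult)
qed (simp_all add: generated_algebra_const[of 1, folded one_fun_def])

lemma generated_algebra_diff:
  "x \<in> generated_algebra G \<Longrightarrow> y \<in> generated_algebra G \<Longrightarrow> x - y \<in> generated_algebra G"
  unfolding generated_algebra_def by (rule fun_space.span_diff)

text \<open>A space of countable dimension is a countable increasing union of finite-dimensional
  subspaces, one of which must receive infinitely many members of the family. The relation is
  indexed by \<open>C\<close>, not by the values of \<open>u\<close>, so coinciding values are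
  treated first, by the relation \<open>u c - u d = 0\<close>.\<close>

lemma uncountable_family_dependent:
  fixes u :: "complex \<Rightarrow> 'w \<Rightarrow> complex"
  assumes G: "countable G" and C: "uncountable C"
    and u: "\<And>c. c \<in> C \<Longrightarrow> u c \<in> generated_algebra G"
  obtains S a where "finite S" "S \<subseteq> C" "\<exists>c\<in>S. a c \<noteq> 0" "\<And>w. (\<Sum>c\<in>S. a c * u c w) = 0"
proof (cases "inj_on u C")
  case False
  then obtain c d where cd: "c \<in> C" "d \<in> C" "c \<noteq> d" "u c = u d"
    by (auto simp: inj_on_def)
  show ?thesis
    by (rule that[of "{c,d}" "\<lambda>x. if x = c then 1 else - 1"]) (use cd in auto)
next
  case True
  define N where "N = prod_list ` lists G"
  have N: "countable N" "N \<noteq> {}"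
    unfolding N_def using countable_lists[OF G] by auto
  define e where "e = from_nat_into N"
  have eN: "range e = N" unfolding e_def using N by (rule range_from_nat_into[rotated])
  have "\<not> (\<forall>k. finite {c\<in>C. u c \<in> fun_space.span (e ` {..k})})"
  proof
    assume *: "\<forall>k. finite {c\<in>C. u c \<in> fun_space.span (e ` {..k})}"
    have "C \<subseteq> (\<Union>k. {c\<in>C. u c \<in> fun_space.span (e ` {..k})})"
    proof
      fix c assume c: "c \<in> C"
      have "u c \<in> fun_space.span N" using u[OF c] by (simp add: generated_algebra_def N_def)
      then obtain t r where tr: "finite t" "t \<subseteq> N" "u c = (\<Sum>a\<in>t. fun_scale (r a) a)"
        unfolding fun_space.span_explicit by blast
      obtain T where T: "finite T" "t = e ` T"
        using finite_subset_image[OF tr(1), of e UNIV] tr(2) eN by auto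
      obtain k where "T \<subseteq> {..k}" using T(1) finite_nat_iff_bounded_le by auto
      then have "t \<subseteq> e ` {..k}" using T by auto
      then have "u c \<in> fun_space.span (e ` {..k})"
        unfolding tr(3) by (intro fun_space.span_sum fun_space.span_scale fun_space.span_base) auto
      then show "c \<in> (\<Union>k. {c\<in>C. u c \<in> fun_space.span (e ` {..k})})" using c by auto
    qed
    moreover have "countable (\<Union>k. {c\<in>C. u c \<in> fun_space.span (e ` {..k})})"
      using * by (intro countable_UN) (auto intro: countable_finite)
    ultimately show False using C countable_subset by blast
  qed
  then obtain k where k: "infinite {c\<in>C. u c \<in> fun_space.span (e ` {..k})}" by blast
  define X where "X = {c\<in>C. u c \<in> fun_space.span (e ` {..k})}"
  have "infinite (u ` X)"
    using k True by (metis (no_types, lifting) X_def finite_image_iff inj_on_subset mem_Collect_eq subsetI)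
  moreover have "u ` X \<subseteq> fun_space.span (e ` {..k})" by (auto simp: X_def)
  ultimately have "fun_space.dependent (u ` X)"
    using fun_space.independent_span_bound[of "e ` {..k}" "u ` X"] by auto
  then obtain t r where tr: "finite t" "t \<subseteq> u ` X" "(\<Sum>v\<in>t. fun_scale (r v) v) = 0" "\<exists>v\<in>t. r v \<noteq> 0"
    unfolding fun_space.dependent_explicit by blast
  obtain S where S: "S \<subseteq> X" "finite S" "t = u ` S" using finite_subset_image[OF tr(1,2)] by blast
  have inj: "inj_on u S" using True S by (auto simp: X_def intro: inj_on_subset)
  show ?thesis
  proof (rule that[of S "r \<circ> u"])
    show "S \<subseteq> C" using S by (auto simp: X_def)
    fix w
    have "(\<Sum>v\<in>t. fun_scale (r v) v) w = (\<Sum>c\<in>S. r (u c) * u c w)"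
      unfolding S(3) by (simp add: sum.reindex[OF inj] o_def sum_fun_apply)
    then show "(\<Sum>c\<in>S. (r \<circ> u) c * u c w) = 0" using tr(3) by simp
  qed (use tr S in auto)
qed

section \<open>Ideals and the weak Nullstellensatz in countable dimension\<close>

definition is_ideal :: "('w \<Rightarrow> complex) set \<Rightarrow> ('w \<Rightarrow> complex) set \<Rightarrow> bool" where
  "is_ideal B I \<longleftrightarrow> I \<subseteq> B \<and> 0 \<in> I \<and> (\<forall>x\<in>I. \<forall>y\<in>I. x + y \<in> I) \<and> (\<forall>x\<in>I. \<forall>y\<in>B. y * x \<in> I)"

lemma is_ideal_sum:
  assumes "is_ideal B I" "\<And>i. i \<in> S \<Longrightarrow> f i \<in> I"
  shows "(\<Sum>i\<in>S. f i) \<in> I"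
  using assms(2)
proof (induction S rule: infinite_finite_induct)
  case (insert x F)
  then have "f x \<in> I" "sum f F \<in> I" by blast+
  then show ?case unfolding sum.insert[OF insert.hyps] using assms(1) unfolding is_ideal_def by blast
qed (use assms(1) in \<open>auto simp: is_ideal_def\<close>)

text \<open>If \<open>b - c\<close> is a unit modulo \<open>I\<close> for uncountably many \<open>c\<close>, the inverses are linearly
  dependent, because the algebra has countable dimension; clearing denominators gives \<open>p\<close>.\<close>

lemma polynomial_in_ideal:
  assumes G: "countable G" and I: "is_ideal (generated_algebra G) I"
    and b: "b \<in> generated_algebra G" and C: "uncountable C"
    and u: "\<And>c. c \<in> C \<Longrightarrow> \<exists>u\<in>generated_algebra G. u * (b - (\<lambda>_. c)) - 1 \<in> I"
  obtains p where "p \<noteq> 0" "(\<lambda>w. poly p (b w)) \<in> I"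
proof -
  let ?B = "generated_algebra G"
  obtain u where u: "\<forall>c\<in>C. u c \<in> ?B \<and> u c * (b - (\<lambda>_. c)) - 1 \<in> I"
    using bchoice[of C "\<lambda>c u. u \<in> ?B \<and> u * (b - (\<lambda>_. c)) - 1 \<in> I"] u by blast
  obtain S a where S: "finite S" "S \<subseteq> C" "\<exists>c\<in>S. a c \<noteq> 0" "\<And>w. (\<Sum>c\<in>S. a c * u c w) = 0"
    by (rule uncountable_family_dependent[OF G C, of u]) (use u in auto)
  \<comment> \<open>This is the numerator of the sum of the fractions \<open>a c / (b - c)\<close>.
    At a node \<open>c0\<close> with \<open>a c0 \<noteq> 0\<close> all summands but one vanish, so
    \<open>p\<close> is nonzero.\<close>
  define p where "p = (\<Sum>c\<in>S. smult (a c) (\<Prod>d\<in>S-{c}. [:-d, 1:]))"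
  obtain c0 where c0: "c0 \<in> S" "a c0 \<noteq> 0" using S by blast
  have "poly p c0 = (\<Sum>c\<in>S. a c * (\<Prod>d\<in>S-{c}. c0 - d))"
    by (simp add: p_def poly_sum poly_prod)
  also have "\<dots> = (\<Sum>c\<in>S. if c = c0 then a c * (\<Prod>d\<in>S-{c}. c0 - d) else 0)"
    using S(1) c0 by (intro sum.cong) (auto simp: prod_zero_iff)
  also have "\<dots> = a c0 * (\<Prod>d\<in>S-{c0}. c0 - d)" using S(1) c0 by simp
  also have "\<dots> \<noteq> 0" using S(1) c0 by (auto simp: prod_zero_iff)
  finally have "p \<noteq> 0" by auto
  \<comment> \<open>When \<open>u c * (b - c) - 1\<close> is multiplied by \<open>q c\<close> and
    summed, the first parts add up to a multiple of \<open>\<Sum>c\<in>S. a c * u c\<close>, which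
    is zero, and the second parts to \<open>p(b)\<close>.\<close>
  define q where "q c = (\<lambda>_::'a. - a c) * (\<Prod>d\<in>S-{c}. b - (\<lambda>_. d))" for c
  have q: "q c \<in> ?B" for c unfolding q_def
    by (intro generated_algebra_mult generated_algebra_prod generated_algebra_diff
        generated_algebra_const b)
  have "(\<Sum>c\<in>S. q c * (u c * (b - (\<lambda>_. c)) - 1)) \<in> I"
    using u S(2) I q by (intro is_ideal_sum[OF I]) (auto simp: is_ideal_def)
  moreover have "(\<Sum>c\<in>S. q c * (u c * (b - (\<lambda>_. c)) - 1)) = (\<lambda>w. poly p (b w))"
  proof
    fix w
    have "(\<Sum>c\<in>S. q c * (u c * (b - (\<lambda>_. c)) - 1)) w
      = (\<Sum>c\<in>S. - (a c * u c w) * ((b w - c) * (\<Prod>d\<in>S-{c}. b w - d)) + a c * (\<Prod>d\<in>S-{c}. b w - d))"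
      by (simp add: q_def sum_fun_apply prod_fun_apply algebra_simps)
    also have "\<dots> = (\<Sum>c\<in>S. - (a c * u c w) * (\<Prod>d\<in>S. b w - d) + a c * (\<Prod>d\<in>S-{c}. b w - d))"
      using S(1) by (intro sum.cong refl) (simp add: prod.remove)
    also have "\<dots> = - (\<Sum>c\<in>S. a c * u c w) * (\<Prod>d\<in>S. b w - d) + poly p (b w)"
      by (simp only: sum.distrib sum_distrib_right sum_negf p_def poly_sum poly_prod poly_smult poly_pCons) (simp add: sum_subtractf sum_negf sum_distrib_right)
    finally show "(\<Sum>c\<in>S. q c * (u c * (b - (\<lambda>_. c)) - 1)) w = poly p (b w)" using S(4) by simp
  qed
  ultimately show ?thesis using that \<open>p \<noteq> 0\<close> by simp
qed

lemma maximal_ideal_exists: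
  assumes I0: "is_ideal B I0" "1 \<notin> I0"
  obtains J where "is_ideal B J" "1 \<notin> J" "I0 \<subseteq> J"
    "\<And>K. is_ideal B K \<Longrightarrow> 1 \<notin> K \<Longrightarrow> J \<subseteq> K \<Longrightarrow> K = J"
proof -
  define F where "F = {K. is_ideal B K \<and> 1 \<notin> K \<and> I0 \<subseteq> K}"
  have "\<exists>J\<in>F. \<forall>X\<in>F. J \<subseteq> X \<longrightarrow> X = J"
  proof (rule subset_Zorn_nonempty)
    show "F \<noteq> {}" using I0 by (auto simp: F_def)
    fix C assume C: "C \<noteq> {}" "subset.chain F C"
    have CF: "K \<in> F" if "K \<in> C" for K using that C by (auto simp: subset.chain_def)
    have "x + y \<in> \<Union>C" if xy: "x \<in> \<Union>C" "y \<in> \<Union>C" for x y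
    proof -
      obtain K L where "K \<in> C" "x \<in> K" "L \<in> C" "y \<in> L" using xy by blast
      moreover from this have "K \<subseteq> L \<or> L \<subseteq> K" using C by (auto simp: subset.chain_def)
      ultimately obtain M where "M \<in> C" "x \<in> M" "y \<in> M" by blast
      then have "x + y \<in> M" using CF[of M] by (auto simp: F_def is_ideal_def)
      then show ?thesis using \<open>M \<in> C\<close> by blast
    qed
    moreover have "y * x \<in> \<Union>C" if "x \<in> \<Union>C" "y \<in> B" for x y
      using that CF by (fastforce simp: F_def is_ideal_def)
    moreover have "\<Union>C \<subseteq> B" "0 \<in> \<Union>C" "1 \<notin> \<Union>C" "I0 \<subseteq> \<Union>C"
      using CF C(1) by (fastforce simp: F_def is_ideal_def)+
    ultimately show "\<Union>C \<in> F" unfolding F_def is_ideal_def by blast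
  qed
  then show ?thesis using that by (fastforce simp: F_def)
qed

text \<open>Being the identity on constants and multiplicative makes \<open>\<sigma>\<close>
  complex-linear, hence a unital homomorphism of complex algebras.\<close>

definition algebra_hom :: "('w \<Rightarrow> complex) set \<Rightarrow> (('w \<Rightarrow> complex) \<Rightarrow> complex) \<Rightarrow> bool" where
  "algebra_hom B \<sigma> \<longleftrightarrow> (\<forall>c. \<sigma> (\<lambda>_. c) = c) \<and>
     (\<forall>x\<in>B. \<forall>y\<in>B. \<sigma> (x + y) = \<sigma> x + \<sigma> y) \<and> (\<forall>x\<in>B. \<forall>y\<in>B. \<sigma> (x * y) = \<sigma> x * \<sigma> y)"

text \<open>The residue field is the complex numbers. Otherwise every \<open>b - c\<close> is a unit
  modulo \<open>J\<close> by maximality, \<open>polynomial_in_ideal\<close> yields a nonzero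
  \<open>p\<close> with \<open>p(b)\<close> in \<open>J\<close>, and dividing off its linear
  factors, all units, leaves a nonzero constant in \<open>J\<close>.\<close>

lemma maximal_ideal_residue:
  assumes G: "countable G" and J: "is_ideal (generated_algebra G) J" "1 \<notin> J"
    and max: "\<And>K. is_ideal (generated_algebra G) K \<Longrightarrow> 1 \<notin> K \<Longrightarrow> J \<subseteq> K \<Longrightarrow> K = J"
    and b: "b \<in> generated_algebra G"
  shows "\<exists>!c. b - (\<lambda>_. c) \<in> J"
proof -
  let ?B = "generated_algebra G"
  have JB: "J \<subseteq> ?B" and J0: "0 \<in> J" and Ja: "\<And>x y. x \<in> J \<Longrightarrow> y \<in> J \<Longrightarrow> x + y \<in> J"
    and Jm: "\<And>x y. x \<in> J \<Longrightarrow> y \<in> ?B \<Longrightarrow> y * x \<in> J"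
    using J(1) unfolding is_ideal_def by blast+
  have const: "c = 0" if "(\<lambda>_. c) \<in> J" for c
  proof (rule ccontr)
    assume "c \<noteq> 0"
    then have "(\<lambda>_. inverse c) * (\<lambda>_. c) = (1 :: 'a \<Rightarrow> complex)" by (auto simp: fun_eq_iff)
    then show False using Jm[OF that generated_algebra_const] J(2) by metis
  qed
  have "\<exists>c. b - (\<lambda>_. c) \<in> J"
  proof (rule ccontr)
    assume no: "\<not> ?thesis"
    have unit: "\<exists>u\<in>?B. u * (b - (\<lambda>_. c)) - 1 \<in> J" for c
    proof (rule ccontr)
      assume nu: "\<not> ?thesis"
      let ?x = "b - (\<lambda>_. c)"
      have xB: "?x \<in> ?B" by (intro generated_algebra_diff b generated_algebra_const)
      \<comment> \<open>The ideal generated by \<open>J\<close> and \<open>?x\<close>. It is proper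
        because \<open>?x\<close> is no unit modulo \<open>J\<close>, so it equals \<open>J\<close>
        by maximality and \<open>?x\<close> lies in \<open>J\<close>.\<close>
      define K where "K = {y + u * ?x | y u. y \<in> J \<and> u \<in> ?B}"
      have 0: "0 \<in> ?B" using J0 JB by blast
      have 1: "1 \<in> ?B" using generated_algebra_const[of 1] by (simp add: one_fun_def)
      have "is_ideal ?B K"
        unfolding is_ideal_def
      proof (intro conjI ballI)
        show "K \<subseteq> ?B" using JB xB by (auto simp: K_def intro!: generated_algebra_add generated_algebra_mult)
        have "0 = 0 + 0 * ?x" by simp
        then show "0 \<in> K" using J0 0 unfolding K_def by blast
      next
        fix x y assume "x \<in> K" "y \<in> K"
        then obtain x1 x2 y1 y2 where *: "x = x1 + x2 * ?x" "y = y1 + y2 * ?x"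
          "x1 \<in> J" "y1 \<in> J" "x2 \<in> ?B" "y2 \<in> ?B" by (auto simp: K_def)
        have "x + y = (x1 + y1) + (x2 + y2) * ?x" unfolding *(1,2) by (simp add: algebra_simps)
        then show "x + y \<in> K" unfolding K_def using Ja[OF *(3,4)] generated_algebra_add[OF *(5,6)] by blast
      next
        fix x y assume "x \<in> K" "y \<in> ?B"
        then obtain x1 x2 where *: "x = x1 + x2 * ?x" "x1 \<in> J" "x2 \<in> ?B" by (auto simp: K_def)
        have "y * x = y * x1 + (y * x2) * ?x" unfolding *(1) by (simp add: algebra_simps)
        then show "y * x \<in> K"
          unfolding K_def using Jm[OF *(2) \<open>y \<in> ?B\<close>] generated_algebra_mult[OF \<open>y \<in> ?B\<close> *(3)] by blast
      qed
      moreover have "J \<subseteq> K"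
      proof
        fix y assume "y \<in> J"
        moreover have "y = y + 0 * ?x" by simp
        ultimately show "y \<in> K" using 0 unfolding K_def by blast
      qed
      moreover have "1 \<notin> K"
      proof
        assume "1 \<in> K"
        then obtain y u where yu: "1 = y + u * ?x" "y \<in> J" "u \<in> ?B" by (auto simp: K_def)
        have "u * ?x - 1 = (\<lambda>_. - 1) * y" using yu(1) by (auto simp: fun_eq_iff algebra_simps)
        then have "u * ?x - 1 \<in> J" using Jm[OF yu(2) generated_algebra_const] by metis
        then show False using nu yu by blast
      qed
      ultimately have "K = J" using max by blast
      moreover have "?x = 0 + 1 * ?x" by simp
      then have "?x \<in> K" unfolding K_def using J0 1 by blast
      ultimately show False using no by blast
    qed
    obtain p where p: "p \<noteq> 0" "(\<lambda>w. poly p (b w)) \<in> J"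
      using polynomial_in_ideal[OF G J(1) b, of UNIV] unit uncountable_UNIV_complex by metis
    have "(\<lambda>w. poly p (b w)) \<in> J \<Longrightarrow> p \<noteq> 0 \<Longrightarrow> False" for p
    proof (induction "degree p" arbitrary: p)
      case 0
      then obtain c where "p = [:c:]" using degree_eq_zeroE by metis
      then show False using 0 const by auto
    next
      case (Suc n)
      then have "\<not> constant (poly p)" by (simp add: constant_degree)
      then obtain z where z: "poly p z = 0" using fundamental_theorem_of_algebra by blast
      then obtain q where q: "p = [:-z, 1:] * q" by (auto simp: poly_eq_0_iff_dvd elim: dvdE)
      have q0: "q \<noteq> 0" using q Suc by auto
      have "degree p = degree [:-z, 1:] + degree q"
        unfolding q by (rule degree_mult_eq) (use q0 in auto)
      then have dq: "n = degree q" using Suc.hyps(2) by simp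
      have pB: "(\<lambda>w. poly p (b w)) \<in> generated_algebra G" for p
      proof (induction p)
        case (pCons c p)
        have "(\<lambda>w. poly (pCons c p) (b w)) = (\<lambda>_. c) + b * (\<lambda>w. poly p (b w))"
          by (auto simp: fun_eq_iff)
        then show ?case
          using pCons b by (metis generated_algebra_add generated_algebra_const generated_algebra_mult)
      qed (use generated_algebra_const in simp)
      obtain u where u: "u \<in> ?B" "u * (b - (\<lambda>_. z)) - 1 \<in> J" using unit by blast
      \<comment> \<open>Modulo \<open>J\<close> the factor \<open>b - z\<close> has the inverse
        \<open>u\<close>, so \<open>q(b)\<close> is congruent to \<open>u * p(b)\<close>; the last
        summand is the correction.\<close>
      have "(\<lambda>w. poly q (b w)) = u * (\<lambda>w. poly p (b w)) +
          (\<lambda>w. - poly q (b w)) * (u * (b - (\<lambda>_. z)) - 1)"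
        by (auto simp: fun_eq_iff q algebra_simps)
      also have "\<dots> \<in> J"
        using pB[of "-q"] u Suc.prems Jm Ja by auto
      finally show False using Suc.hyps(1)[OF dq] q0 by blast
    qed
    then show False using p by blast
  qed
  moreover have "c = d" if "b - (\<lambda>_. c) \<in> J" "b - (\<lambda>_. d) \<in> J" for c d
  proof -
    have "(\<lambda>_. c - d) = (b - (\<lambda>_. d)) + (\<lambda>_. - 1) * (b - (\<lambda>_. c))"
      by (auto simp: fun_eq_iff)
    then have "(\<lambda>_. c - d) \<in> J" using that Ja Jm generated_algebra_const by metis
    then show ?thesis using const by fastforce
  qed
  ultimately show ?thesis by blast
qed

text \<open>Having infinite range, \<open>b\<close> is annihilated by no nonzero polynomial. By
  \<open>polynomial_in_ideal\<close> for the zero ideal, \<open>b - c\<close> cannot be invertible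
  for all of the uncountably many \<open>c\<close> of norm above \<open>R\<close>; reduction modulo
  a maximal ideal containing a noninvertible \<open>b - c\<close> takes the value \<open>c\<close>
  at \<open>b\<close>.\<close>

lemma algebra_hom_large:
  fixes b :: "'w \<Rightarrow> complex"
  assumes G: "countable G" and b: "b \<in> generated_algebra G" and inf: "infinite (range b)"
  obtains \<sigma> where "algebra_hom (generated_algebra G) \<sigma>" "norm (\<sigma> b) > R"
proof -
  let ?B = "generated_algebra G"
  have BI: "is_ideal ?B {0}"
    using generated_algebra_const[of 0 G] by (auto simp: is_ideal_def zero_fun_def)
  have "\<exists>c\<in>- cball 0 R. \<not> (\<exists>u\<in>?B. u * (b - (\<lambda>_. c)) - 1 \<in> {0})"
  proof (rule ccontr)
    assume "\<not> ?thesis"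
    moreover have "uncountable (- cball (0::complex) R)"
    proof (rule notI)
      assume "countable (- cball (0::complex) R)"
      moreover have "ball (of_real (\<bar>R\<bar> + 1)) 1 \<subseteq> - cball (0::complex) R"
      proof
        fix x :: complex assume "x \<in> ball (of_real (\<bar>R\<bar> + 1)) 1"
        then have "norm (of_real (\<bar>R\<bar> + 1) - x) < 1" by (simp add: dist_norm)
        moreover have "norm (of_real (\<bar>R\<bar> + 1) :: complex) = \<bar>R\<bar> + 1"
          by (simp only: norm_of_real)
        moreover have "norm (of_real (\<bar>R\<bar> + 1) :: complex) \<le> norm (of_real (\<bar>R\<bar> + 1) - x) + norm x"
          by (metis diff_add_cancel norm_triangle_ineq)
        ultimately show "x \<in> - cball 0 R" by (simp add: dist_norm)
      qed
      ultimately show False using countable_subset uncountable_ball[of 1 "of_real (\<bar>R\<bar> + 1) :: complex"] by auto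
    qed
    ultimately obtain p where p: "p \<noteq> 0" "(\<lambda>w. poly p (b w)) \<in> {0}"
      using polynomial_in_ideal[OF G BI b] by metis
    then have "range b \<subseteq> {z. poly p z = 0}" by (auto simp: fun_eq_iff)
    then show False using poly_roots_finite[OF p(1)] inf finite_subset by blast
  qed
  then obtain c where c: "norm c > R" "\<And>u. u \<in> ?B \<Longrightarrow> u * (b - (\<lambda>_. c)) \<noteq> 1"
    by (auto simp: not_le)
  define I0 where "I0 = {u * (b - (\<lambda>_. c)) | u. u \<in> ?B}"
  have I0: "is_ideal ?B I0"
    unfolding is_ideal_def
  proof (intro conjI ballI)
    show "I0 \<subseteq> ?B"
      using b by (auto simp: I0_def intro!: generated_algebra_mult generated_algebra_diff generated_algebra_const)
    have "0 = 0 * (b - (\<lambda>_. c))" "0 \<in> ?B" using BI by (auto simp: is_ideal_def)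
    then show "0 \<in> I0" unfolding I0_def by blast
    fix x assume "x \<in> I0"
    then obtain u where u: "x = u * (b - (\<lambda>_. c))" "u \<in> ?B" by (auto simp: I0_def)
    { fix y assume "y \<in> I0"
      then obtain v where v: "y = v * (b - (\<lambda>_. c))" "v \<in> ?B" by (auto simp: I0_def)
      have "x + y = (u + v) * (b - (\<lambda>_. c))" by (simp add: u v algebra_simps)
      then show "x + y \<in> I0" unfolding I0_def using generated_algebra_add[OF u(2) v(2)] by blast }
    { fix y assume "y \<in> ?B"
      have "y * x = (y * u) * (b - (\<lambda>_. c))" by (simp add: u algebra_simps)
      then show "y * x \<in> I0" unfolding I0_def using generated_algebra_mult[OF \<open>y \<in> ?B\<close> u(2)] by blast }
  qed
  moreover have "1 \<notin> I0" using c(2) by (auto simp: I0_def)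
  ultimately obtain J where J: "is_ideal ?B J" "1 \<notin> J" "I0 \<subseteq> J"
    and max: "\<And>K. is_ideal ?B K \<Longrightarrow> 1 \<notin> K \<Longrightarrow> J \<subseteq> K \<Longrightarrow> K = J"
    using maximal_ideal_exists by metis
  note residue = maximal_ideal_residue[OF G J(1,2) max]
  define \<sigma> where "\<sigma> x = (THE c. x - (\<lambda>_. c) \<in> J)" for x
  have \<sigma>: "x - (\<lambda>_. \<sigma> x) \<in> J" if "x \<in> ?B" for x
    unfolding \<sigma>_def by (rule theI') (rule residue[OF _ _ _ that])
  have \<sigma>_eq: "\<sigma> x = c" if "x - (\<lambda>_. c) \<in> J" "x \<in> ?B" for x c
    using residue[OF _ _ _ that(2)] that(1) \<sigma>[OF that(2)] by blast
  have Ja: "\<And>x y. x \<in> J \<Longrightarrow> y \<in> J \<Longrightarrow> x + y \<in> J"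
    and Jm: "\<And>x y. x \<in> J \<Longrightarrow> y \<in> ?B \<Longrightarrow> y * x \<in> J"
    using J(1) unfolding is_ideal_def by blast+
  have "\<sigma> (\<lambda>_. d) = d" for d
    using J(1) by (intro \<sigma>_eq generated_algebra_const) (auto simp: is_ideal_def)
  moreover have "\<sigma> (x + y) = \<sigma> x + \<sigma> y" if "x \<in> ?B" "y \<in> ?B" for x y
  proof (rule \<sigma>_eq)
    have "x + y - (\<lambda>_. \<sigma> x + \<sigma> y) = (x - (\<lambda>_. \<sigma> x)) + (y - (\<lambda>_. \<sigma> y))" by (auto simp: fun_eq_iff)
    then show "x + y - (\<lambda>_. \<sigma> x + \<sigma> y) \<in> J" using \<sigma> that Ja by metis
  qed (use that generated_algebra_add in blast)
  moreover have "\<sigma> (x * y) = \<sigma> x * \<sigma> y" if "x \<in> ?B" "y \<in> ?B" for x y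
  proof (rule \<sigma>_eq)
    have "x * y - (\<lambda>_. \<sigma> x * \<sigma> y) = y * (x - (\<lambda>_. \<sigma> x)) + (\<lambda>_. \<sigma> x) * (y - (\<lambda>_. \<sigma> y))"
      by (auto simp: fun_eq_iff algebra_simps)
    then show "x * y - (\<lambda>_. \<sigma> x * \<sigma> y) \<in> J"
      using \<sigma> that Ja Jm generated_algebra_const by metis
  qed (use that generated_algebra_mult in blast)
  moreover have "\<sigma> b = c"
  proof (rule \<sigma>_eq)
    have "1 * (b - (\<lambda>_. c)) \<in> I0"
      unfolding I0_def using generated_algebra_const[of 1 G] by (auto simp: one_fun_def)
    then show "b - (\<lambda>_. c) \<in> J" using J by auto
  qed (rule b)
  ultimately show ?thesis using that[of \<sigma>] c(1) by (auto simp: algebra_hom_def)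
qed

section \<open>Independent families, normalized limits and polarization\<close>

definition lin_indep_on :: "'z set \<Rightarrow> 'j set \<Rightarrow> ('j \<Rightarrow> 'z \<Rightarrow> complex) \<Rightarrow> bool" where
  "lin_indep_on D J g \<longleftrightarrow>
     (\<forall>c. (\<forall>z\<in>D. (\<Sum>j\<in>J. c j * g j z) = 0) \<longrightarrow> (\<forall>j\<in>J. c j = 0))"

text \<open>Greedy choice: an index is added only if its function is not yet in the span on
  \<open>D\<close>. The matrix \<open>T\<close> is recorded because it later moves the dropped
  functions of \<open>z\<close> into the coefficient functions of \<open>w\<close>.\<close>

lemma lin_indep_subfamily:
  assumes "finite J"
  obtains J' T where "J' \<subseteq> J" "lin_indep_on D J' g"
    "\<And>i z. i \<in> J \<Longrightarrow> z \<in> D \<Longrightarrow> g i z = (\<Sum>j\<in>J'. T i j * g j z)"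
proof -
  have "\<exists>J' T. J' \<subseteq> J \<and> lin_indep_on D J' g \<and>
    (\<forall>i\<in>J. \<forall>z\<in>D. g i z = (\<Sum>j\<in>J'. T i j * g j z))"
    using assms
  proof (induction J)
    case empty
    then show ?case by (auto simp: lin_indep_on_def)
  next
    case (insert x J)
    then obtain J' T where IH: "J' \<subseteq> J" "lin_indep_on D J' g"
      "\<forall>i\<in>J. \<forall>z\<in>D. g i z = (\<Sum>j\<in>J'. T i j * g j z)" by blast
    have fin: "finite J'" and xJ': "x \<notin> J'" using IH(1) insert.hyps finite_subset by auto
    show ?case
    proof (cases "\<exists>c. \<forall>z\<in>D. g x z = (\<Sum>j\<in>J'. c j * g j z)")
      case True
      then obtain c where c: "\<forall>z\<in>D. g x z = (\<Sum>j\<in>J'. c j * g j z)" by blast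
      show ?thesis
        using IH c insert.hyps
        by (intro exI[of _ J'] exI[of _ "T(x := c)"]) auto
    next
      case False
      have "lin_indep_on D (insert x J') g"
        unfolding lin_indep_on_def
      proof (intro allI impI)
        fix c assume c: "\<forall>z\<in>D. (\<Sum>j\<in>insert x J'. c j * g j z) = 0"
        have "c x = 0"
        proof (rule ccontr)
          assume cx: "c x \<noteq> 0"
          have "g x z = (\<Sum>j\<in>J'. (- c j / c x) * g j z)" if "z \<in> D" for z
          proof -
            have "c x * g x z + (\<Sum>j\<in>J'. c j * g j z) = 0"
              using c that fin xJ' by simp
            then have "c x * g x z = - (\<Sum>j\<in>J'. c j * g j z)" by (simp add: eq_neg_iff_add_eq_0)
            then have "g x z = - (\<Sum>j\<in>J'. c j * g j z) / c x"
              using cx by (simp add: field_simps)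
            then show ?thesis by (simp add: sum_divide_distrib sum_negf)
          qed
          then show False using False by meson
        qed
        then have "\<forall>j\<in>J'. c j = 0" using c fin xJ' IH(2) by (auto simp: lin_indep_on_def)
        then show "\<forall>j\<in>insert x J'. c j = 0" using \<open>c x = 0\<close> by auto
      qed
      moreover have "g i z = (\<Sum>j\<in>insert x J'. (if i = x then (if j = x then 1 else 0)
          else (if j = x then 0 else T i j)) * g j z)" if "i \<in> insert x J" "z \<in> D" for i z
      proof -
        have "(\<Sum>j\<in>J'. (if j = x then 1 else 0) * g j z) = 0" using xJ' by (intro sum.neutral) auto
        moreover have "(\<Sum>j\<in>J'. (if j = x then 0 else T i j) * g j z) = (\<Sum>j\<in>J'. T i j * g j z)"
          using xJ' by (intro sum.cong) auto
        ultimately show ?thesis using that IH(3) fin xJ' by auto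
      qed
      ultimately show ?thesis
        using IH(1)
        by (intro exI[of _ "insert x J'"] exI[of _ "\<lambda>i j. if i = x then (if j = x then 1 else 0)
          else (if j = x then 0 else T i j)"] conjI) auto
    qed
  qed
  then show ?thesis using that by blast
qed

lemma lin_indep_on_nonzero:
  assumes "lin_indep_on D J g" "\<exists>j\<in>J. c j \<noteq> 0"
  obtains z where "z \<in> D" "(\<Sum>j\<in>J. c j * g j z) \<noteq> 0"
  using assms unfolding lin_indep_on_def by metis

section \<open>Compactness of normalized coefficient vectors\<close>

lemma convergent_subsequence_family:
  fixes x :: "nat \<Rightarrow> 'j \<Rightarrow> complex"
  assumes "finite J" "\<And>n j. j \<in> J \<Longrightarrow> norm (x n j) \<le> C"
  obtains r y where "strict_mono r" "\<And>j. j \<in> J \<Longrightarrow> (\<lambda>n. x (r n) j) \<longlonglongrightarrow> y j"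
proof -
  have "\<exists>r y. strict_mono (r :: nat \<Rightarrow> nat) \<and> (\<forall>j\<in>J. (\<lambda>n. x (r n) j) \<longlonglongrightarrow> y j)"
    using assms
  proof (induction J)
    case empty
    then show ?case by (auto intro: exI[of _ id] simp: strict_mono_def)
  next
    case (insert k J)
    then obtain r y where r: "strict_mono (r :: nat \<Rightarrow> nat)" "\<forall>j\<in>J. (\<lambda>n. x (r n) j) \<longlonglongrightarrow> y j"
      by (metis insert_iff)
    have "bounded (range (\<lambda>n. x (r n) k))" using insert.prems by (auto simp: bounded_iff)
    then obtain l q where q: "strict_mono (q :: nat \<Rightarrow> nat)" "((\<lambda>n. x (r n) k) \<circ> q) \<longlonglongrightarrow> l"
      using bounded_imp_convergent_subsequence by blast
    have "(\<lambda>n. x ((r \<circ> q) n) j) \<longlonglongrightarrow> (y(k := l)) j" if "j \<in> insert k J" for j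
    proof (cases "j = k")
      case True
      then show ?thesis using q(2) by (simp add: o_def)
    next
      case False
      then have "(\<lambda>n. x (r n) j) \<longlonglongrightarrow> y j" using r that by auto
      from LIMSEQ_subseq_LIMSEQ[OF this q(1)] show ?thesis using False by (simp add: o_def)
    qed
    then show ?case using strict_mono_o[OF r(1) q(1)] by blast
  qed
  then show ?thesis using that by blast
qed

text \<open>Division by the sum of the norms puts the vectors on a compact unit sphere, so the limit
  again has norm \<open>1\<close> and cannot vanish.\<close>

lemma normalized_subsequence:
  fixes x :: "nat \<Rightarrow> 'j \<Rightarrow> complex"
  assumes J: "finite J" and nz: "\<And>n. \<exists>j\<in>J. x n j \<noteq> 0"
  obtains r y where "strict_mono r" "\<exists>j\<in>J. y j \<noteq> 0"
    "\<And>j. j \<in> J \<Longrightarrow> (\<lambda>n. x (r n) j / of_real (\<Sum>i\<in>J. norm (x (r n) i))) \<longlonglongrightarrow> y j"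
proof -
  define N where "N n = (\<Sum>i\<in>J. norm (x n i))" for n
  have N: "N n > 0" for n
    unfolding N_def using nz[of n] J by (metis norm_ge_zero sum_pos2 zero_less_norm_iff)
  have "norm (x n j / of_real (N n)) \<le> 1" if "j \<in> J" for n j
  proof -
    have "norm (x n j) \<le> N n" unfolding N_def using J that by (intro member_le_sum) auto
    then show ?thesis using N[of n] by (simp add: norm_divide divide_le_eq)
  qed
  then obtain r y where r: "strict_mono r"
    "\<And>j. j \<in> J \<Longrightarrow> (\<lambda>n. x (r n) j / of_real (N (r n))) \<longlonglongrightarrow> y j"
    using convergent_subsequence_family[OF J, of "\<lambda>n j. x n j / of_real (N n)" 1] by metis
  have "(\<lambda>n. \<Sum>j\<in>J. norm (x (r n) j / of_real (N (r n)))) \<longlonglongrightarrow> (\<Sum>j\<in>J. norm (y j))"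
    by (intro tendsto_intros r)
  moreover have "(\<Sum>j\<in>J. norm (x (r n) j / of_real (N (r n)))) = 1" for n
  proof -
    have "(\<Sum>j\<in>J. norm (x (r n) j / of_real (N (r n)))) = (\<Sum>j\<in>J. norm (x (r n) j)) / N (r n)"
      using N[of "r n"] by (simp add: norm_divide sum_divide_distrib)
    then show ?thesis using N[of "r n"] by (simp add: N_def)
  qed
  ultimately have "(\<lambda>n. 1) \<longlonglongrightarrow> (\<Sum>j\<in>J. norm (y j))" by (simp only:)
  then have "(\<Sum>j\<in>J. norm (y j)) = 1" using LIMSEQ_unique[OF tendsto_const] by metis
  then have "\<exists>j\<in>J. y j \<noteq> 0" by (rule contrapos_pp) simp
  then show ?thesis using that r by (auto simp: N_def)
qed

section \<open>Identity theorem on the reals and polarization\<close>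

lemma holomorphic_zero_on_reals:
  assumes "f holomorphic_on ball 0 e" "e > 0" "\<And>t::real. \<bar>t\<bar> < e \<Longrightarrow> f (of_real t) = 0" "z \<in> ball 0 e"
  shows "f z = 0"
proof (rule analytic_continuation[of f "ball 0 e" "of_real ` {-e<..<e}" 0])
  show "complex_of_real ` {-e<..<e} \<subseteq> ball 0 e" by auto
  show "(0::complex) islimpt complex_of_real ` {-e<..<e}"
    unfolding islimpt_approachable
  proof (intro allI impI)
    fix d :: real assume "d > 0"
    define t where "t = min d e / 2"
    have "t > 0" "t < d" "t < e" using \<open>d > 0\<close> \<open>e > 0\<close> by (auto simp: t_def)
    then show "\<exists>x'\<in>complex_of_real ` {-e<..<e}. x' \<noteq> 0 \<and> dist x' 0 < d"
      by (intro bexI[of _ "complex_of_real t"]) auto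
  qed
qed (use assms in auto)

text \<open>In the coordinates \<open>z = x + \<i> y\<close>, \<open>w = x - \<i> y\<close> the antidiagonal \<open>w = cnj z\<close> is the real
  plane, so the one-variable identity theorem applies first in \<open>x\<close>, then in \<open>y\<close>.\<close>

lemma polarization:
  fixes F :: "complex \<Rightarrow> complex \<Rightarrow> complex"
  assumes e: "e > 0"
    and hol: "\<And>a b c d. a \<in> {1,\<i>} \<Longrightarrow> b \<in> {1,-\<i>} \<Longrightarrow> norm c < e \<Longrightarrow> norm d < e \<Longrightarrow>
      (\<lambda>x. F (a * x + c) (b * x + d)) holomorphic_on ball 0 e"
    and diag: "\<And>z. norm z < 2 * e \<Longrightarrow> F z (cnj z) = 0"
    and z: "norm z < e" and w: "norm w < e"
  shows "F z w = 0"
proof -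
  \<comment> \<open>Here \<open>x\<close> is complex and \<open>y\<close> still real. For real
    \<open>t\<close> the two arguments are conjugate and of norm below \<open>2 * e\<close>, hence
    the radius in \<open>diag\<close>.\<close>
  have 1: "F (x + \<i> * of_real y) (x - \<i> * of_real y) = 0" if "norm x < e" "\<bar>y\<bar> < e" for x y
  proof -
    have "(\<lambda>x. F (1 * x + \<i> * of_real y) (1 * x + (- \<i> * of_real y))) x = 0"
    proof (rule holomorphic_zero_on_reals[of "\<lambda>x. F (1 * x + \<i> * of_real y) (1 * x + (- \<i> * of_real y))" e])
      show "(\<lambda>x. F (1 * x + \<i> * of_real y) (1 * x + (- \<i> * of_real y))) holomorphic_on ball 0 e"
        by (intro hol) (use that in \<open>auto simp: norm_mult\<close>)
      fix t :: real assume t: "\<bar>t\<bar> < e"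
      have "norm (of_real t + \<i> * of_real y) \<le> \<bar>t\<bar> + \<bar>y\<bar>"
        by (metis norm_triangle_ineq norm_of_real norm_mult norm_ii mult_1)
      then have "F (of_real t + \<i> * of_real y) (cnj (of_real t + \<i> * of_real y)) = 0"
        using t that by (intro diag) auto
      then show "F (1 * of_real t + \<i> * of_real y) (1 * of_real t + (- \<i> * of_real y)) = 0"
        by simp
    qed (use that e in auto)
    then show ?thesis by simp
  qed
  have 2: "F (x + \<i> * y) (x - \<i> * y) = 0" if "norm x < e" "norm y < e" for x y
  proof -
    have "(\<lambda>y. F (\<i> * y + x) (- \<i> * y + x)) y = 0"
    proof (rule holomorphic_zero_on_reals[of "\<lambda>y. F (\<i> * y + x) (- \<i> * y + x)" e])
      show "(\<lambda>y. F (\<i> * y + x) (- \<i> * y + x)) holomorphic_on ball 0 e"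
        by (intro hol) (use that in auto)
      fix t :: real assume "\<bar>t\<bar> < e"
      from 1[OF \<open>norm x < e\<close> this] show "F (\<i> * of_real t + x) (- \<i> * of_real t + x) = 0"
        by (simp add: add.commute)
    qed (use that e in auto)
    then show ?thesis by (simp add: add.commute)
  qed
  \<comment> \<open>These are the solutions \<open>x\<close> and \<open>y\<close> of
    \<open>z = x + \<i> * y\<close>, \<open>w = x - \<i> * y\<close>.\<close>
  have "norm ((z + w) / 2) < e" "norm ((z - w) / (2 * \<i>)) < e"
    using z w norm_triangle_ineq[of z w] norm_triangle_ineq4[of z w]
    by (auto simp: norm_divide norm_mult)
  from 2[OF this] show ?thesis by (simp add: field_simps)
qed

section \<open>Orders of vanishing\<close>

text \<open>The derivative is multiplied by \<open>w - z\<close> so that the exponent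
  \<open>n\<close> is kept and \<open>n = 0\<close> needs no separate formula with a truncated
  \<open>n - 1\<close>.\<close>

lemma holomorphic_zero_factor:
  assumes hol: "f holomorphic_on S" and S: "open S" "connected S" "z \<in> S" and nz: "\<exists>w\<in>S. f w \<noteq> 0"
  obtains n g r where "r > 0" "ball z r \<subseteq> S" "g holomorphic_on ball z r" "g z \<noteq> 0"
    "f z = 0 \<Longrightarrow> n > 0"
    "\<And>w. w \<in> ball z r \<Longrightarrow> f w = (w - z) ^ n * g w"
    "\<And>w. w \<in> ball z r \<Longrightarrow>
       (w - z) * deriv f w = (w - z) ^ n * (of_nat n * g w + (w - z) * deriv g w)"
proof -
  define n where "n = nat (zorder f z)"
  define g where "g = zor_poly f z"
  obtain r where r: "if f z = 0 then zorder f z > 0 else zorder f z = 0" "r > 0" "cball z r \<subseteq> S"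
    "g holomorphic_on cball z r" "\<And>w. w \<in> cball z r \<Longrightarrow> f w = g w * (w - z) ^ n \<and> g w \<noteq> 0"
    using zorder_exist_zero[OF hol S nz] unfolding n_def g_def by blast
  have fg: "f w = (w - z) ^ n * g w" if "w \<in> ball z r" for w using r(5)[of w] that by auto
  have gh: "g holomorphic_on ball z r" using r(4) holomorphic_on_subset ball_subset_cball by blast
  show ?thesis
  proof (rule that[of r g n])
    show "f z = 0 \<Longrightarrow> n > 0" using r(1) by (simp add: n_def)
    fix w assume w: "w \<in> ball z r"
    have "(g has_field_derivative deriv g w) (at w)" using gh w holomorphic_derivI by blast
    then have "((\<lambda>w. (w - z) ^ n * g w) has_field_derivative
        (w - z) ^ n * deriv g w + of_nat n * (w - z) ^ (n - 1) * g w) (at w)"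
      by (auto intro!: derivative_eq_intros)
    then have "(f has_field_derivative
        (w - z) ^ n * deriv g w + of_nat n * (w - z) ^ (n - 1) * g w) (at w)"
      by (rule has_field_derivative_transform_within_open[where S = "ball z r"]) (use w fg in auto)
    then have "deriv f w = (w - z) ^ n * deriv g w + of_nat n * (w - z) ^ (n - 1) * g w"
      by (rule DERIV_imp_deriv)
    note deriv_f = this
    have "x * (A * D + N * B * C) = A * (x * D) + N * (x * B) * C" for x A D N B C :: complex
      by (simp add: algebra_simps)
    from this[of "w - z"] have "(w - z) * deriv f w =
        (w - z) ^ n * ((w - z) * deriv g w) + of_nat n * ((w - z) * (w - z) ^ (n - 1)) * g w"
      unfolding deriv_f by blast
    also have "of_nat n * ((w - z) * (w - z) ^ (n - 1)) = (of_nat n * (w - z) ^ n :: complex)"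
      by (cases n) auto
    finally have "(w - z) * deriv f w =
        (w - z) ^ n * ((w - z) * deriv g w) + of_nat n * (w - z) ^ n * g w" .
    moreover have "A * (x * D) + N * A * C = A * (N * C + x * D)" for x A D N C :: complex
      by (simp add: algebra_simps)
    ultimately show "(w - z) * deriv f w = (w - z) ^ n * (of_nat n * g w + (w - z) * deriv g w)"
      by (simp only:)
  qed (use r fg gh in auto)
qed

text \<open>Away from \<open>z\<close> the power cancels; continuity carries the equality to
  \<open>z\<close> itself.\<close>

lemma cancel_power_at:
  fixes p q :: "complex \<Rightarrow> complex"
  assumes "r > 0" "isCont p z" "isCont q z"
    "\<And>w. w \<in> ball z r \<Longrightarrow> (w - z) ^ k * p w = (w - z) ^ k * q w"
  shows "p z = q z"
proof -
  have "\<forall>\<^sub>F w in at z. p w = q w"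
    unfolding eventually_at using assms(1,4) by (intro exI[of _ r]) (auto simp: dist_commute)
  then have "(q \<longlongrightarrow> p z) (at z)"
    using assms(2) unfolding isCont_def by (rule Lim_transform_eventually[rotated])
  then show ?thesis using assms(3) LIM_unique unfolding isCont_def by blast
qed

text \<open>The equation says that \<open>U / V\<close> has
  derivative \<open>c F' / F\<close> if \<open>d = 0\<close>, and logarithmic derivative \<open>d F' / F\<close> if \<open>c = 0\<close>.\<close>

lemma order_comparison:
  fixes F U V :: "complex \<Rightarrow> complex"
  assumes hol: "F holomorphic_on S" "U holomorphic_on S" "V holomorphic_on S"
    and S: "open S" "connected S" "z0 \<in> S" and F0: "F z0 = 0"
    and nz: "\<exists>z\<in>S. F z \<noteq> 0" "\<exists>z\<in>S. U z \<noteq> 0" "\<exists>z\<in>S. V z \<noteq> 0"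
    and ode: "\<And>z. z \<in> S \<Longrightarrow>
      F z * (V z * deriv U z - U z * deriv V z) = V z * (c * V z + d * U z) * deriv F z"
  shows "d = 0 \<Longrightarrow> c = 0" and "c = 0 \<Longrightarrow> d \<in> \<rat>"
proof -
  obtain m f r1 where f: "r1 > 0" "ball z0 r1 \<subseteq> S" "f holomorphic_on ball z0 r1" "f z0 \<noteq> 0"
    "F z0 = 0 \<Longrightarrow> m > 0" "\<And>w. w \<in> ball z0 r1 \<Longrightarrow> F w = (w - z0) ^ m * f w"
    "\<And>w. w \<in> ball z0 r1 \<Longrightarrow>
       (w - z0) * deriv F w = (w - z0) ^ m * (of_nat m * f w + (w - z0) * deriv f w)"
    by (rule holomorphic_zero_factor[OF hol(1) S nz(1)]) blast
  obtain a u r2 where u: "r2 > 0" "ball z0 r2 \<subseteq> S" "u holomorphic_on ball z0 r2" "u z0 \<noteq> 0"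
    "U z0 = 0 \<Longrightarrow> a > 0" "\<And>w. w \<in> ball z0 r2 \<Longrightarrow> U w = (w - z0) ^ a * u w"
    "\<And>w. w \<in> ball z0 r2 \<Longrightarrow>
       (w - z0) * deriv U w = (w - z0) ^ a * (of_nat a * u w + (w - z0) * deriv u w)"
    by (rule holomorphic_zero_factor[OF hol(2) S nz(2)]) blast
  obtain b v r3 where v: "r3 > 0" "ball z0 r3 \<subseteq> S" "v holomorphic_on ball z0 r3" "v z0 \<noteq> 0"
    "V z0 = 0 \<Longrightarrow> b > 0" "\<And>w. w \<in> ball z0 r3 \<Longrightarrow> V w = (w - z0) ^ b * v w"
    "\<And>w. w \<in> ball z0 r3 \<Longrightarrow>
       (w - z0) * deriv V w = (w - z0) ^ b * (of_nat b * v w + (w - z0) * deriv v w)"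
    by (rule holomorphic_zero_factor[OF hol(3) S nz(3)]) blast
  define r where "r = min r1 (min r2 r3)"
  have r: "r > 0" using f(1) u(1) v(1) by (simp add: r_def)
  \<comment> \<open>\<open>P\<close> and \<open>Q\<close> are cofactors left when powers of
    \<open>w - z0\<close> are taken out of the equation multiplied by \<open>w - z0\<close>. At
    \<open>z0\<close>, \<open>P\<close> is a nonzero multiple of the difference \<open>a - b\<close>
    of the orders of \<open>U\<close> and \<open>V\<close>, and \<open>Q\<close> a nonzero multiple
    of the order \<open>m\<close> of \<open>F\<close>.\<close>
  define P where "P w = f w * (v w * (of_nat a * u w + (w - z0) * deriv u w)
                              - u w * (of_nat b * v w + (w - z0) * deriv v w))" for w
  define Q where "Q w = v w * (of_nat m * f w + (w - z0) * deriv f w)" for w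
  have key: "(w - z0) ^ (m + b) * ((w - z0) ^ a * P w) =
      (w - z0) ^ (m + b) * (Q w * (c * (w - z0) ^ b * v w + d * (w - z0) ^ a * u w))"
    if w: "w \<in> ball z0 r" for w
  proof -
    have w': "w \<in> ball z0 r1" "w \<in> ball z0 r2" "w \<in> ball z0 r3" using w by (auto simp: r_def)
    have "(w - z0) * (F w * (V w * deriv U w - U w * deriv V w))
        = F w * (V w * ((w - z0) * deriv U w) - U w * ((w - z0) * deriv V w))"
      by (simp add: algebra_simps)
    also have "\<dots> = (w - z0) ^ (m + b) * ((w - z0) ^ a * P w)"
      unfolding u(7)[OF w'(2)] v(7)[OF w'(3)] u(6)[OF w'(2)] v(6)[OF w'(3)] f(6)[OF w'(1)] P_def power_add
      by (simp add: algebra_simps)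
    finally have 1: "(w - z0) * (F w * (V w * deriv U w - U w * deriv V w))
        = (w - z0) ^ (m + b) * ((w - z0) ^ a * P w)" .
    have "(w - z0) * (V w * (c * V w + d * U w) * deriv F w)
        = V w * (c * V w + d * U w) * ((w - z0) * deriv F w)"
      by (simp add: algebra_simps)
    also have "\<dots> = (w - z0) ^ (m + b) * (Q w * (c * (w - z0) ^ b * v w + d * (w - z0) ^ a * u w))"
      unfolding f(7)[OF w'(1)] u(6)[OF w'(2)] v(6)[OF w'(3)] Q_def power_add
      by (simp add: algebra_simps)
    finally have 2: "(w - z0) * (V w * (c * V w + d * U w) * deriv F w)
      = (w - z0) ^ (m + b) * (Q w * (c * (w - z0) ^ b * v w + d * (w - z0) ^ a * u w))" .
    have "w \<in> S" using w' f(2) by blast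
    from ode[OF this] 1 2 show ?thesis by metis
  qed
  have hol': "f holomorphic_on ball z0 r" "u holomorphic_on ball z0 r" "v holomorphic_on ball z0 r"
    by (auto intro!: holomorphic_on_subset[OF f(3)] holomorphic_on_subset[OF u(3)]
        holomorphic_on_subset[OF v(3)] simp: r_def)
  have z0: "z0 \<in> ball z0 r" using r by simp
  have "P holomorphic_on ball z0 r" "Q holomorphic_on ball z0 r"
    unfolding P_def Q_def by (auto intro!: holomorphic_intros hol' holomorphic_deriv)
  then have "isCont P z0" "isCont Q z0" "isCont u z0" "isCont v z0"
    using hol' r holomorphic_on_imp_continuous_on continuous_on_eq_continuous_at[OF open_ball] z0
    by blast+
  note cont = this
  have m: "m > 0" using f(5) F0 by blast
  have P0: "P z0 = f z0 * u z0 * v z0 * (of_nat a - of_nat b)"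
    by (simp add: P_def algebra_simps)
  have Q0: "Q z0 = of_nat m * f z0 * v z0" by (simp add: Q_def)
  show "c = 0 \<Longrightarrow> d \<in> \<rat>"
  proof -
    assume c: "c = 0"
    \<comment> \<open>Both sides contain the power \<open>m + b + a\<close>; equating what remains
      at \<open>z0\<close> gives \<open>a - b = m * d\<close>.\<close>
    have "P z0 = (\<lambda>w. Q w * d * u w) z0"
    proof (rule cancel_power_at[OF r, of z0 P "\<lambda>w. Q w * d * u w" "m + b + a"])
      show "(w - z0) ^ (m + b + a) * P w = (w - z0) ^ (m + b + a) * (Q w * d * u w)"
        if "w \<in> ball z0 r" for w
        using key[OF that] c by (simp add: power_add algebra_simps)
    qed (use cont in \<open>auto intro!: continuous_intros\<close>)
    then have "(of_nat a - of_nat b) * (f z0 * u z0 * v z0) = of_nat m * d * (f z0 * u z0 * v z0)"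
      unfolding P0 Q0 by (simp add: algebra_simps)
    then have "of_nat a - of_nat b = of_nat m * d" using f(4) u(4) v(4) by simp
    then have "d = (of_nat a - of_nat b) / of_nat m" using m by (simp add: field_simps)
    then show "d \<in> \<rat>" by simp
  qed
  show "d = 0 \<Longrightarrow> c = 0"
  proof -
    assume d: "d = 0"
    show "c = 0"
    proof (cases "a < b")
      case True
      define k where "k = b - a"
      have k: "b = a + k" "k > 0" using True by (auto simp: k_def)
      \<comment> \<open>Here \<open>U / V\<close> has a pole of order \<open>k\<close>, so its
        derivative has one of order \<open>k + 1\<close>, while \<open>c * F' / F\<close> has at
        most a simple pole. After cancellation \<open>(w - z0) ^ k\<close> remains on the right and
        forces \<open>a = b\<close>.\<close>
      have "P z0 = (\<lambda>w. Q w * (c * (w - z0) ^ k * v w)) z0"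
      proof (rule cancel_power_at[OF r, of z0 P "\<lambda>w. Q w * (c * (w - z0) ^ k * v w)" "m + b + a"])
        show "(w - z0) ^ (m + b + a) * P w = (w - z0) ^ (m + b + a) * (Q w * (c * (w - z0) ^ k * v w))"
          if "w \<in> ball z0 r" for w
          using key[OF that] d by (simp add: power_add k(1) algebra_simps)
      qed (use cont in \<open>auto intro!: continuous_intros\<close>)
      then have "P z0 = 0" using k by simp
      then have "(of_nat a :: complex) = of_nat b" unfolding P0 using f(4) u(4) v(4) by simp
      then show ?thesis using True by simp
    next
      case False
      define k where "k = a - b"
      have k: "a = b + k" using False by (auto simp: k_def)
      \<comment> \<open>Without a pole of \<open>U / V\<close> the left side vanishes at
        \<open>z0\<close>: for \<open>k > 0\<close> because of the power, for \<open>k = 0\<close>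
        because \<open>P z0\<close> contains the factor \<open>a - b\<close>. So the residue of
        \<open>c * F' / F\<close> is zero.\<close>
      have "(\<lambda>w. (w - z0) ^ k * P w) z0 = (\<lambda>w. Q w * (c * v w)) z0"
      proof (rule cancel_power_at[OF r, of z0 "\<lambda>w. (w - z0) ^ k * P w" "\<lambda>w. Q w * (c * v w)" "m + b + b"])
        show "(w - z0) ^ (m + b + b) * ((w - z0) ^ k * P w) = (w - z0) ^ (m + b + b) * (Q w * (c * v w))"
          if "w \<in> ball z0 r" for w
          using key[OF that] d by (simp add: power_add k algebra_simps)
      qed (use cont in \<open>auto intro!: continuous_intros\<close>)
      moreover have "(z0 - z0) ^ k * P z0 = 0" by (cases "k = 0") (auto simp: P0 k)
      ultimately have "Q z0 * (c * v z0) = 0" by simp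
      then show ?thesis unfolding Q0 using f(4) v(4) m by simp
    qed
  qed
qed

section \<open>Specialization of finite-rank kernels\<close>

lemma algebra_hom_lincomb:
  assumes \<sigma>: "algebra_hom (generated_algebra G) \<sigma>" and x: "\<And>i. i \<in> I \<Longrightarrow> x i \<in> generated_algebra G"
  shows "(\<lambda>w. \<Sum>i\<in>I. c i * x i w) \<in> generated_algebra G"
    and "\<sigma> (\<lambda>w. \<Sum>i\<in>I. c i * x i w) = (\<Sum>i\<in>I. c i * \<sigma> (x i))"
proof -
  have "(\<lambda>w. \<Sum>i\<in>I. c i * x i w) \<in> generated_algebra G \<and>
      \<sigma> (\<lambda>w. \<Sum>i\<in>I. c i * x i w) = (\<Sum>i\<in>I. c i * \<sigma> (x i))"
    using x
  proof (induction I rule: infinite_finite_induct)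
    case (insert j I)
    let ?y = "\<lambda>w. \<Sum>i\<in>I. c i * x i w"
    have eq: "(\<lambda>w. \<Sum>i\<in>insert j I. c i * x i w) = (\<lambda>_. c j) * x j + ?y"
      using insert.hyps by (auto simp: fun_eq_iff)
    have xj: "x j \<in> generated_algebra G" using insert.prems by blast
    have IH: "?y \<in> generated_algebra G" "\<sigma> ?y = (\<Sum>i\<in>I. c i * \<sigma> (x i))"
      using insert by blast+
    have cx: "(\<lambda>_. c j) * x j \<in> generated_algebra G"
      by (intro generated_algebra_mult generated_algebra_const xj)
    have "\<sigma> ((\<lambda>_. c j) * x j + ?y) = \<sigma> ((\<lambda>_. c j) * x j) + \<sigma> ?y"
      using \<sigma> cx IH(1) unfolding algebra_hom_def by blast
    also have "\<sigma> ((\<lambda>_. c j) * x j) = \<sigma> (\<lambda>_. c j) * \<sigma> (x j)"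
      using \<sigma> generated_algebra_const xj unfolding algebra_hom_def by blast
    also have "\<sigma> (\<lambda>_. c j) = c j" using \<sigma> unfolding algebra_hom_def by blast
    finally have "\<sigma> ((\<lambda>_. c j) * x j + ?y) = (\<Sum>i\<in>insert j I. c i * \<sigma> (x i))"
      unfolding IH(2) sum.insert[OF insert.hyps] .
    then show ?case unfolding eq using generated_algebra_add[OF cx IH(1)] by blast
  qed (use generated_algebra_const[of 0 G] \<sigma> in \<open>auto simp: algebra_hom_def\<close>)
  then show "(\<lambda>w. \<Sum>i\<in>I. c i * x i w) \<in> generated_algebra G"
    "\<sigma> (\<lambda>w. \<Sum>i\<in>I. c i * x i w) = (\<Sum>i\<in>I. c i * \<sigma> (x i))" by blast+
qed

text \<open>A kernel of finite rank, with the second variable hidden in the coefficient vector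
  \<open>e\<close>. Specializing the kernel means replacing this vector by the values of a
  homomorphism.\<close>

definition comb :: "'i set \<Rightarrow> ('i \<Rightarrow> 'z \<Rightarrow> complex) \<Rightarrow> ('i \<Rightarrow> complex) \<Rightarrow> 'z \<Rightarrow> complex" where
  "comb I x e z = (\<Sum>i\<in>I. x i z * e i)"

lemma holomorphic_comb:
  "(\<And>i. i \<in> I \<Longrightarrow> x i holomorphic_on D) \<Longrightarrow> comb I x e holomorphic_on D"
  unfolding comb_def[abs_def] by (intro holomorphic_intros)

lemma deriv_comb:
  assumes "\<And>i. i \<in> I \<Longrightarrow> x i holomorphic_on D" "open D" "z \<in> D"
  shows "deriv (comb I x e) z = comb I (\<lambda>i. deriv (x i)) e z"
  unfolding comb_def[abs_def]
  by (intro DERIV_imp_deriv derivative_intros DERIV_cmult_right holomorphic_derivI[OF assms(1,2)])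
    (use assms in auto)

lemma comb_nonzero: "comb I x e z \<noteq> 0 \<Longrightarrow> \<exists>i\<in>I. e i \<noteq> 0"
  by (rule ccontr) (simp add: comb_def)

lemma comb_divide: "comb I x (\<lambda>i. e i / N) z = comb I x e z / N"
  by (simp add: comb_def sum_divide_distrib)

lemma lin_indep_comb:
  assumes "lin_indep_on D I x" "\<exists>i\<in>I. e i \<noteq> 0"
  shows "\<exists>z\<in>D. comb I x e z \<noteq> 0"
  using lin_indep_on_nonzero[OF assms] unfolding comb_def by (metis (no_types, lifting) mult.commute sum.cong)

text \<open>The equation satisfied by \<open>U / V = E(P)\<close> for \<open>E = ln (1 + _)\<close>, \<open>exp\<close> and a power of \<open>1 + _\<close>,
  for suitable constants, with the denominators cleared.\<close>

definition ratio_ode ::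
  "complex \<Rightarrow> complex \<Rightarrow> complex \<Rightarrow> complex \<Rightarrow> complex set \<Rightarrow>
    (complex \<Rightarrow> complex) \<Rightarrow> (complex \<Rightarrow> complex) \<Rightarrow> (complex \<Rightarrow> complex) \<Rightarrow> bool" where
  "ratio_ode a b c d D P U V \<longleftrightarrow> (\<forall>z\<in>D.
     (a + b * P z) * (V z * deriv U z - U z * deriv V z) = V z * (c * V z + d * U z) * deriv P z)"

text \<open>For fixed \<open>z\<close> the equation is a polynomial identity among the functions
  \<open>\<eta> i\<close>, \<open>k j\<close>, \<open>l j\<close> of \<open>w\<close>, so it
  survives a homomorphism; differentiation in \<open>z\<close> affects only its complex
  coefficients. Nonvanishing of \<open>k j0\<close> and \<open>l l0\<close> survives because their
  inverses belong to the algebra.\<close>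

lemma specialize_ratio_ode:
  fixes \<eta> :: "'i \<Rightarrow> 'w \<Rightarrow> complex" and k :: "'j \<Rightarrow> 'w \<Rightarrow> complex" and l :: "'l \<Rightarrow> 'w \<Rightarrow> complex"
  assumes fin: "finite I" "finite J" "finite L" and D: "open D"
    and hol: "\<And>i. i \<in> I \<Longrightarrow> \<phi> i holomorphic_on D" "\<And>j. j \<in> J \<Longrightarrow> g j holomorphic_on D"
      "\<And>j. j \<in> L \<Longrightarrow> f j holomorphic_on D"
    and ode: "\<And>w. ratio_ode a b c d D (comb I \<phi> (\<lambda>i. \<eta> i w)) (comb L f (\<lambda>i. l i w))
       (comb J g (\<lambda>i. k i w))"
    and j0: "j0 \<in> J" "\<And>w. k j0 w \<noteq> 0" and l0: "l0 \<in> L" "\<And>w. l l0 w \<noteq> 0"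
    and inf: "infinite (range (\<lambda>w. comb I \<phi> (\<lambda>i. \<eta> i w) z1))"
  shows "\<exists>e u v. norm (comb I \<phi> e z1) > R \<and> (\<exists>j\<in>L. u j \<noteq> 0) \<and> (\<exists>j\<in>J. v j \<noteq> 0) \<and>
    ratio_ode a b c d D (comb I \<phi> e) (comb L f u) (comb J g v)"
proof -
  define G where "G = \<eta> ` I \<union> k ` J \<union> l ` L \<union> {\<lambda>w. inverse (k j0 w), \<lambda>w. inverse (l l0 w)}"
  let ?B = "generated_algebra G"
  have G: "countable G" unfolding G_def using fin by (intro countable_finite) auto
  have gen: "\<And>i. i \<in> I \<Longrightarrow> \<eta> i \<in> ?B" "\<And>i. i \<in> J \<Longrightarrow> k i \<in> ?B" "\<And>i. i \<in> L \<Longrightarrow> l i \<in> ?B"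
    "(\<lambda>w. inverse (k j0 w)) \<in> ?B" "(\<lambda>w. inverse (l l0 w)) \<in> ?B"
    by (auto simp: G_def intro!: generated_algebra_gen)
  have "comb I \<phi> (\<lambda>i. \<eta> i w) z1 = (\<Sum>i\<in>I. \<phi> i z1 * \<eta> i w)" for w by (simp add: comb_def)
  moreover have "(\<lambda>w. \<Sum>i\<in>I. c i * x i w) \<in> ?B" if "\<And>i. i \<in> I \<Longrightarrow> x i \<in> ?B" for I :: "'i set" and c x
  proof -
    have "(\<lambda>w. \<Sum>i\<in>I. c i * x i w) = (\<Sum>i\<in>I. (\<lambda>_. c i) * x i)"
      by (auto simp: fun_eq_iff sum_fun_apply)
    then show ?thesis
      using generated_algebra_sum[of I "\<lambda>i. (\<lambda>_. c i) * x i" G] generated_algebra_mult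
        generated_algebra_const that by metis
  qed
  ultimately have "(\<lambda>w. comb I \<phi> (\<lambda>i. \<eta> i w) z1) \<in> ?B" using gen(1) by presburger
  from algebra_hom_large[OF G this inf] obtain \<sigma> where \<sigma>: "algebra_hom ?B \<sigma>"
    and large: "norm (\<sigma> (\<lambda>w. comb I \<phi> (\<lambda>i. \<eta> i w) z1)) > R" by blast
  have const: "\<sigma> (\<lambda>_. c) = c" for c using \<sigma> unfolding algebra_hom_def by blast
  have add: "\<sigma> (x + y) = \<sigma> x + \<sigma> y" and mult: "\<sigma> (x * y) = \<sigma> x * \<sigma> y"
    if "x \<in> ?B" "y \<in> ?B" for x y using \<sigma> that unfolding algebra_hom_def by blast+
  define e where "e i = \<sigma> (\<eta> i)" for i
  define u where "u i = \<sigma> (l i)" for i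
  define v where "v i = \<sigma> (k i)" for i
  have combs: "(\<lambda>w. comb I x (\<lambda>i. \<eta> i w) z) \<in> ?B" "\<sigma> (\<lambda>w. comb I x (\<lambda>i. \<eta> i w) z) = comb I x e z"
    "(\<lambda>w. comb J y (\<lambda>i. k i w) z) \<in> ?B" "\<sigma> (\<lambda>w. comb J y (\<lambda>i. k i w) z) = comb J y v z"
    "(\<lambda>w. comb L t (\<lambda>i. l i w) z) \<in> ?B" "\<sigma> (\<lambda>w. comb L t (\<lambda>i. l i w) z) = comb L t u z"
    for x y t and z :: complex
    unfolding comb_def e_def u_def v_def
    by (rule algebra_hom_lincomb[OF \<sigma>], erule gen)+
  have unit: "\<sigma> x \<noteq> 0" if "x \<in> ?B" "(\<lambda>w. inverse (x w)) \<in> ?B" "\<And>w. x w \<noteq> 0" for x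
  proof -
    have "x * (\<lambda>w. inverse (x w)) = (\<lambda>_. 1)" using that(3) by (auto simp: fun_eq_iff)
    then have "\<sigma> x * \<sigma> (\<lambda>w. inverse (x w)) = 1" using mult[OF that(1,2)] const[of 1] by metis
    then show ?thesis by auto
  qed
  have "u l0 \<noteq> 0" "v j0 \<noteq> 0" unfolding u_def v_def
    using unit gen j0 l0 by blast+
  moreover have "norm (comb I \<phi> e z1) > R" using large combs(2) by metis
  moreover have "ratio_ode a b c d D (comb I \<phi> e) (comb L f u) (comb J g v)"
    unfolding ratio_ode_def
  proof
    fix z assume z: "z \<in> D"
    have dc: "deriv (comb I \<phi> e) z = comb I (\<lambda>i. deriv (\<phi> i)) e z"
      "deriv (comb J g v) z = comb J (\<lambda>i. deriv (g i)) v z"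
      "deriv (comb L f u) z = comb L (\<lambda>i. deriv (f i)) u z" for e v u
      by (rule deriv_comb[OF _ D z], erule hol)+
    define P where "P = (\<lambda>w. comb I \<phi> (\<lambda>i. \<eta> i w) z)"
    define P' where "P' = (\<lambda>w. comb I (\<lambda>i. deriv (\<phi> i)) (\<lambda>i. \<eta> i w) z)"
    define V where "V = (\<lambda>w. comb J g (\<lambda>i. k i w) z)"
    define V' where "V' = (\<lambda>w. comb J (\<lambda>i. deriv (g i)) (\<lambda>i. k i w) z)"
    define U where "U = (\<lambda>w. comb L f (\<lambda>i. l i w) z)"
    define U' where "U' = (\<lambda>w. comb L (\<lambda>i. deriv (f i)) (\<lambda>i. l i w) z)"
    note defs = P_def P'_def V_def V'_def U_def U'_def
    have mem: "P \<in> ?B" "P' \<in> ?B" "V \<in> ?B" "V' \<in> ?B" "U \<in> ?B" "U' \<in> ?B"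
      unfolding defs using combs by blast+
    let ?A = "(\<lambda>_. a) + (\<lambda>_. b) * P" and ?C = "(\<lambda>_. c) * V + (\<lambda>_. d) * U"
    \<comment> \<open>\<open>algebra_hom\<close> speaks of sums and products, hence the form without
      subtraction.\<close>
    have "?A * (V * U') = ?A * (U * V') + V * ?C * P'"
    proof
      fix w
      have "(a + b * P w) * (V w * U' w - U w * V' w) = V w * (c * V w + d * U w) * P' w"
        using bspec[OF ode[of w, unfolded ratio_ode_def] z] unfolding defs dc .
      then show "(?A * (V * U')) w = (?A * (U * V') + V * ?C * P') w"
        by (simp add: algebra_simps)
    qed
    then have "\<sigma> (?A * (V * U')) = \<sigma> (?A * (U * V') + V * ?C * P')" by (simp only:)
    then have "(a + b * \<sigma> P) * (\<sigma> V * \<sigma> U') =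
        (a + b * \<sigma> P) * (\<sigma> U * \<sigma> V') + \<sigma> V * (c * \<sigma> V + d * \<sigma> U) * \<sigma> P'"
      by (simp only: add mult const mem generated_algebra_add generated_algebra_mult generated_algebra_const)
    then have "(a + b * \<sigma> P) * (\<sigma> V * \<sigma> U' - \<sigma> U * \<sigma> V') = \<sigma> V * (c * \<sigma> V + d * \<sigma> U) * \<sigma> P'"
      by (simp add: algebra_simps)
    then show "(a + b * comb I \<phi> e z) *
          (comb J g v z * deriv (comb L f u) z - comb L f u z * deriv (comb J g v) z) =
         comb J g v z * (c * comb J g v z + d * comb L f u z) * deriv (comb I \<phi> e) z"
      unfolding defs combs by (simp add: dc)
  qed
  ultimately show ?thesis using j0 l0 by blast
qed

text \<open>Independence of the selected functions of \<open>z\<close> ensures that nonzero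
  coefficient vectors give nonzero functions. Large specializations exist because the kernel at
  \<open>z1\<close> is a nonconstant function of \<open>w\<close>: it is zero at \<open>0\<close>
  and nonzero at \<open>w1\<close>.\<close>

lemma specializations_exist:
  fixes \<eta> :: "'i \<Rightarrow> complex \<Rightarrow> complex" and k :: "'j \<Rightarrow> complex \<Rightarrow> complex"
    and l :: "'l \<Rightarrow> complex \<Rightarrow> complex"
  assumes fin: "finite I" "finite J" "finite L" and D: "open D" "connected D" "0 \<in> D"
    and hol: "\<And>i. i \<in> I \<Longrightarrow> \<phi> i holomorphic_on D" "\<And>j. j \<in> J \<Longrightarrow> g j holomorphic_on D"
      "\<And>j. j \<in> L \<Longrightarrow> f j holomorphic_on D"
    and hol': "\<And>i. i \<in> I \<Longrightarrow> \<eta> i holomorphic_on D" "\<And>j. j \<in> J \<Longrightarrow> k j holomorphic_on D"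
      "\<And>j. j \<in> L \<Longrightarrow> l j holomorphic_on D"
    and zero: "\<And>i. i \<in> I \<Longrightarrow> \<eta> i 0 = 0"
    and ode: "\<And>w. w \<in> D \<Longrightarrow> ratio_ode a b c d D (comb I \<phi> (\<lambda>i. \<eta> i w)) (comb L f (\<lambda>i. l i w))
       (comb J g (\<lambda>i. k i w))"
    and pt: "z1 \<in> D" "w1 \<in> D" "comb I \<phi> (\<lambda>i. \<eta> i w1) z1 \<noteq> 0" "comb L f (\<lambda>i. l i w1) z1 \<noteq> 0"
      "comb J g (\<lambda>i. k i w1) z1 \<noteq> 0"
  obtains I' J' L' where "I' \<subseteq> I" "J' \<subseteq> J" "L' \<subseteq> L"
    "lin_indep_on D I' \<phi>" "lin_indep_on D J' g" "lin_indep_on D L' f"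
    "\<And>R. \<exists>e u v. norm (comb I' \<phi> e z1) > R \<and> (\<exists>j\<in>L'. u j \<noteq> 0) \<and> (\<exists>j\<in>J'. v j \<noteq> 0) \<and>
       ratio_ode a b c d D (comb I' \<phi> e) (comb L' f u) (comb J' g v)"
proof -
  \<comment> \<open>Rewriting the functions of \<open>z\<close> through a subfamily applies the
    transpose of \<open>T\<close> to the coefficients; the kernel is unchanged.\<close>
  have swap: "comb S x q z = comb S' x (\<lambda>j. \<Sum>i\<in>S. T i j * q i) z"
    if "\<And>i. i \<in> S \<Longrightarrow> x i z = (\<Sum>j\<in>S'. T i j * x j z)"
    for S S' :: "'a set" and x :: "'a \<Rightarrow> complex \<Rightarrow> complex" and q z T
  proof -
    have "comb S x q z = (\<Sum>i\<in>S. \<Sum>j\<in>S'. T i j * x j z * q i)"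
      using that unfolding comb_def by (intro sum.cong refl) (simp add: sum_distrib_right)
    also have "\<dots> = (\<Sum>j\<in>S'. \<Sum>i\<in>S. T i j * x j z * q i)" by (rule sum.swap)
    also have "\<dots> = comb S' x (\<lambda>j. \<Sum>i\<in>S. T i j * q i) z"
      unfolding comb_def by (intro sum.cong refl) (simp add: sum_distrib_left mult_ac)
    finally show ?thesis .
  qed
  obtain I' A where I': "I' \<subseteq> I" "lin_indep_on D I' \<phi>"
    "\<And>i z. i \<in> I \<Longrightarrow> z \<in> D \<Longrightarrow> \<phi> i z = (\<Sum>j\<in>I'. A i j * \<phi> j z)"
    using lin_indep_subfamily[OF fin(1)] by blast
  obtain J' B where J': "J' \<subseteq> J" "lin_indep_on D J' g"
    "\<And>i z. i \<in> J \<Longrightarrow> z \<in> D \<Longrightarrow> g i z = (\<Sum>j\<in>J'. B i j * g j z)"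
    using lin_indep_subfamily[OF fin(2)] by blast
  obtain L' C where L': "L' \<subseteq> L" "lin_indep_on D L' f"
    "\<And>i z. i \<in> L \<Longrightarrow> z \<in> D \<Longrightarrow> f i z = (\<Sum>j\<in>L'. C i j * f j z)"
    using lin_indep_subfamily[OF fin(3)] by blast
  define \<eta>' where "\<eta>' j w = (\<Sum>i\<in>I. A i j * \<eta> i w)" for j w
  define k' where "k' j w = (\<Sum>i\<in>J. B i j * k i w)" for j w
  define l' where "l' j w = (\<Sum>i\<in>L. C i j * l i w)" for j w
  have eqs: "comb I \<phi> (\<lambda>i. \<eta> i w) z = comb I' \<phi> (\<lambda>i. \<eta>' i w) z"
    "comb J g (\<lambda>i. k i w) z = comb J' g (\<lambda>i. k' i w) z"
    "comb L f (\<lambda>i. l i w) z = comb L' f (\<lambda>i. l' i w) z" if "z \<in> D" for z w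
    unfolding \<eta>'_def k'_def l'_def
    by (rule swap; use that I' J' L' in blast)+
  have hol2: "\<eta>' j holomorphic_on D" "k' i holomorphic_on D" "l' m holomorphic_on D" for i j m
    unfolding \<eta>'_def k'_def l'_def by (intro holomorphic_intros hol'; assumption)+
  have deriv_eq: "deriv p z = deriv q z" if "\<And>z. z \<in> D \<Longrightarrow> p z = q z" "z \<in> D" for p q z
    using that D(1) by (intro deriv_cong_ev refl eventually_nhds_in_open[THEN eventually_mono]) auto
  have ode': "ratio_ode a b c d D (comb I' \<phi> (\<lambda>i. \<eta>' i w)) (comb L' f (\<lambda>i. l' i w))
       (comb J' g (\<lambda>i. k' i w))" if "w \<in> D" for w
    using ode[OF that] unfolding ratio_ode_def
    by (simp add: eqs deriv_eq[OF eqs(1)] deriv_eq[OF eqs(2)] deriv_eq[OF eqs(3)])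
  obtain j0 where j0: "j0 \<in> J'" "k' j0 w1 \<noteq> 0"
    using comb_nonzero[OF pt(5)[unfolded eqs(2)[OF pt(1)]]] by blast
  obtain l0 where l0: "l0 \<in> L'" "l' l0 w1 \<noteq> 0"
    using comb_nonzero[OF pt(4)[unfolded eqs(3)[OF pt(1)]]] by blast
  have "continuous_on D (k' j0)" "continuous_on D (l' l0)"
    using hol2 holomorphic_on_imp_continuous_on by blast+
  then have "open (D \<inter> k' j0 -` (- {0}))" "open (D \<inter> l' l0 -` (- {0}))"
    using D(1) by (auto intro!: continuous_open_preimage)
  then have "open ((D \<inter> k' j0 -` (- {0})) \<inter> (D \<inter> l' l0 -` (- {0})))" by blast
  moreover have "w1 \<in> (D \<inter> k' j0 -` (- {0})) \<inter> (D \<inter> l' l0 -` (- {0}))" using pt j0 l0 by auto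
  \<comment> \<open>On this ball one coefficient function of \<open>U\<close> and one of
    \<open>V\<close> have no zero, so they can be inverted there.\<close>
  ultimately obtain r where r: "r > 0" "ball w1 r \<subseteq> (D \<inter> k' j0 -` (- {0})) \<inter> (D \<inter> l' l0 -` (- {0}))"
    using open_contains_ball by metis
  define \<mu> where "\<mu> w = comb I' \<phi> (\<lambda>i. \<eta>' i w) z1" for w
  have \<mu>hol: "\<mu> holomorphic_on D"
    unfolding \<mu>_def comb_def by (intro holomorphic_intros hol2)
  \<comment> \<open>A finite continuous image of a connected set is a point, and the identity
    theorem would extend this constancy to \<open>D\<close>, against \<open>\<mu> 0 = 0\<close> and
    \<open>\<mu> w1 \<noteq> 0\<close>.\<close>
  have inf: "infinite (\<mu> ` ball w1 r)"
  proof
    assume "finite (\<mu> ` ball w1 r)"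
    moreover have "continuous_on (ball w1 r) \<mu>"
      using \<mu>hol r(2) holomorphic_on_imp_continuous_on continuous_on_subset by blast
    ultimately have "\<mu> constant_on ball w1 r"
      using continuous_finite_range_constant connected_ball by blast
    then have "\<mu> constant_on D"
      using analytic_continuation'[OF \<mu>hol D(1,2), of "ball w1 r" w1] r pt(2)
      by (auto simp: islimpt_ball)
    then have "\<mu> 0 = \<mu> w1" using D(3) pt(2) unfolding constant_on_def by metis
    moreover have "\<mu> 0 = 0" using zero unfolding \<mu>_def eqs(1)[OF pt(1), symmetric] by (simp add: comb_def)
    moreover have "\<mu> w1 \<noteq> 0" using pt(3) unfolding \<mu>_def eqs(1)[OF pt(1), symmetric] .
    ultimately show False by simp
  qed
  \<comment> \<open>The algebra consists of functions that are total in \<open>w\<close>.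
    Composition with \<open>\<rho>\<close> confines \<open>w\<close> to the ball; the specialization
    is purely algebraic in \<open>w\<close>, so the jump of \<open>\<rho>\<close> is
    harmless.\<close>
  define \<rho> where "\<rho> w = (if w \<in> ball w1 r then w else w1)" for w
  have \<rho>: "\<rho> w \<in> ball w1 r" for w using r(1) by (simp add: \<rho>_def)
  have "\<mu> ` ball w1 r \<subseteq> range (\<lambda>w. \<mu> (\<rho> w))"
  proof
    fix y assume "y \<in> \<mu> ` ball w1 r"
    then obtain w where "w \<in> ball w1 r" "y = \<mu> w" by blast
    then have "y = \<mu> (\<rho> w)" by (simp add: \<rho>_def)
    then show "y \<in> range (\<lambda>w. \<mu> (\<rho> w))" by blast
  qed
  then have inf': "infinite (range (\<lambda>w. comb I' \<phi> (\<lambda>i. \<eta>' i (\<rho> w)) z1))"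
    using inf finite_subset unfolding \<mu>_def by blast
  have \<rho>': "\<rho> w \<in> D" "k' j0 (\<rho> w) \<noteq> 0" "l' l0 (\<rho> w) \<noteq> 0" for w
    using \<rho>[of w] r(2) by auto
  have fin': "finite I'" "finite J'" "finite L'"
    using fin I'(1) J'(1) L'(1) finite_subset by blast+
  have holc: "\<And>i. i \<in> I' \<Longrightarrow> \<phi> i holomorphic_on D" "\<And>j. j \<in> J' \<Longrightarrow> g j holomorphic_on D"
      "\<And>j. j \<in> L' \<Longrightarrow> f j holomorphic_on D"
    using hol I'(1) J'(1) L'(1) by blast+
  show ?thesis
  proof (rule that[OF I'(1) J'(1) L'(1) I'(2) J'(2) L'(2)])
    fix R
    show "\<exists>e u v. norm (comb I' \<phi> e z1) > R \<and> (\<exists>j\<in>L'. u j \<noteq> 0) \<and> (\<exists>j\<in>J'. v j \<noteq> 0) \<and>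
       ratio_ode a b c d D (comb I' \<phi> e) (comb L' f u) (comb J' g v)"
      using specialize_ratio_ode[OF fin' D(1) holc ode'[OF \<rho>'(1)] j0(1) \<rho>'(2) l0(1) \<rho>'(3) inf']
      by blast
  qed
qed

section \<open>Large specializations\<close>

lemma holomorphic_mult_eq_0:
  assumes "p holomorphic_on D" "q holomorphic_on D" "open D" "connected D"
    and pq: "\<And>z. z \<in> D \<Longrightarrow> p z * q z = 0" and p: "\<exists>z\<in>D. p z \<noteq> 0" and z: "z \<in> D"
  shows "q z = 0"
proof -
  let ?S = "D \<inter> p -` (- {0})"
  have "open ?S"
    using assms(1,3) by (intro continuous_open_preimage holomorphic_on_imp_continuous_on) auto
  moreover have "?S \<noteq> {}" using p by auto
  moreover have "D \<noteq> {}" using z by auto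
  ultimately show ?thesis
    using analytic_continuation_open[of ?S D q "\<lambda>_. 0" z] assms pq by auto
qed

lemma sum_norm_pos: "finite I \<Longrightarrow> \<exists>i\<in>I. e i \<noteq> (0::complex) \<Longrightarrow> (\<Sum>i\<in>I. norm (e i)) > 0"
  by (auto intro!: sum_pos2)

lemma tendsto_comb:
  assumes "\<And>i. i \<in> I \<Longrightarrow> (\<lambda>n. e n i) \<longlonglongrightarrow> y i"
  shows "(\<lambda>n. comb I x (e n) z) \<longlonglongrightarrow> comb I x y z"
  unfolding comb_def by (intro tendsto_intros assms)

text \<open>A value above \<open>n\<close> at the fixed point \<open>z\<close> needs coefficients of
  total size at least \<open>n / C\<close>, where \<open>C\<close> is the sum of the norms of the
  \<open>x i z\<close>.\<close>

lemma coefficient_norm_at_top: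
  assumes "finite I" "\<And>n. norm (comb I x (e n) z) > real n"
  shows "(\<lambda>n. 1 / of_real (\<Sum>i\<in>I. norm (e n i)) :: complex) \<longlonglongrightarrow> 0"
proof -
  define C where "C = (\<Sum>i\<in>I. norm (x i z))"
  define N where "N n = (\<Sum>i\<in>I. norm (e n i))" for n
  have "real n < C * N n" for n
  proof -
    have "norm (comb I x (e n) z) \<le> (\<Sum>i\<in>I. norm (x i z) * norm (e n i))"
      unfolding comb_def by (rule sum_norm_le) (simp add: norm_mult)
    also have "\<dots> \<le> (\<Sum>i\<in>I. C * norm (e n i))"
      unfolding C_def using assms(1) by (intro sum_mono mult_right_mono member_le_sum) auto
    also have "\<dots> = C * N n" by (simp add: N_def sum_distrib_left)
    finally show ?thesis using assms(2)[of n] by simp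
  qed
  note bound = this
  have "C \<ge> 0" "N n \<ge> 0" for n by (auto simp: C_def N_def intro: sum_nonneg)
  have "norm (1 / of_real (N n) :: complex) \<le> C / real n" if "n \<ge> 1" for n
  proof -
    have "N n \<noteq> 0" using bound[of n] that by auto
    then have "N n > 0" using \<open>N n \<ge> 0\<close> by simp
    then show ?thesis using bound[of n] that by (simp add: norm_divide field_simps)
  qed
  then have "\<forall>\<^sub>F n in sequentially. norm (1 / of_real (N n) :: complex) \<le> C / real n"
    using eventually_at_top_linorder by blast
  moreover have "(\<lambda>n. C / real n) \<longlonglongrightarrow> 0" by (rule lim_const_over_n)
  ultimately show ?thesis unfolding N_def by (rule Lim_null_comparison)
qed

text \<open>The equation reads \<open>V * U' - U * V' = V * U * P'\<close>. After normalizing all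
  three coefficient vectors, its left side carries the extra factor \<open>1 / Ne\<close>, which
  tends to zero, so the limits satisfy \<open>U * V * P' = 0\<close>. As \<open>U\<close> and
  \<open>V\<close> are not identically zero, \<open>P\<close> is constant, hence zero by its value
  at \<open>0\<close>, against independence.\<close>

lemma no_exponential_specializations:
  assumes fin: "finite I" "finite J" "finite L" and D: "open D" "connected D" "0 \<in> D"
    and hol: "\<And>i. i \<in> I \<Longrightarrow> \<phi> i holomorphic_on D" "\<And>j. j \<in> J \<Longrightarrow> g j holomorphic_on D"
      "\<And>j. j \<in> L \<Longrightarrow> f j holomorphic_on D"
    and zero: "\<And>i. i \<in> I \<Longrightarrow> \<phi> i 0 = 0"
    and indep: "lin_indep_on D I \<phi>" "lin_indep_on D J g" "lin_indep_on D L f"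
    and spec: "\<And>R. \<exists>e u v. norm (comb I \<phi> e z1) > R \<and> (\<exists>j\<in>L. u j \<noteq> 0) \<and> (\<exists>j\<in>J. v j \<noteq> 0) \<and>
       ratio_ode 1 0 0 1 D (comb I \<phi> e) (comb L f u) (comb J g v)"
  shows False
proof -
  obtain e u v where large: "\<And>n::nat. norm (comb I \<phi> (e n) z1) > real n"
    and u: "\<And>n. \<exists>j\<in>L. u n j \<noteq> 0" and v: "\<And>n. \<exists>j\<in>J. v n j \<noteq> 0"
    and ode: "\<And>n. ratio_ode 1 0 0 1 D (comb I \<phi> (e n)) (comb L f (u n)) (comb J g (v n))"
  proof -
    have "\<forall>n::nat. \<exists>e u v. norm (comb I \<phi> e z1) > real n \<and> (\<exists>j\<in>L. u j \<noteq> 0) \<and> (\<exists>j\<in>J. v j \<noteq> 0) \<and>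
       ratio_ode 1 0 0 1 D (comb I \<phi> e) (comb L f u) (comb J g v)" using spec by blast
    then show ?thesis using that by metis
  qed
  have e: "\<exists>i\<in>I. e n i \<noteq> 0" for n
  proof (rule comb_nonzero)
    show "comb I \<phi> (e n) z1 \<noteq> 0" using large[of n] by auto
  qed
  define Ne where "Ne n = (\<Sum>i\<in>I. norm (e n i))" for n
  define Nu where "Nu n = (\<Sum>i\<in>L. norm (u n i))" for n
  define Nv where "Nv n = (\<Sum>i\<in>J. norm (v n i))" for n
  have pos: "Ne n > 0" "Nu n > 0" "Nv n > 0" for n
    unfolding Ne_def Nu_def Nv_def by (intro sum_norm_pos fin e u v)+
  \<comment> \<open>Nested subsequences make the three normalized vectors converge
    simultaneously.\<close>
  obtain r1 y1 where r1: "strict_mono r1" "\<exists>j\<in>I. y1 j \<noteq> 0"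
    "\<And>j. j \<in> I \<Longrightarrow> (\<lambda>n. e (r1 n) j / of_real (Ne (r1 n))) \<longlonglongrightarrow> y1 j"
    by (rule normalized_subsequence[OF fin(1) e, folded Ne_def]) (rule that; assumption)
  obtain r2 y2 where r2: "strict_mono r2" "\<exists>j\<in>L. y2 j \<noteq> 0"
    "\<And>j. j \<in> L \<Longrightarrow> (\<lambda>n. u (r1 (r2 n)) j / of_real (Nu (r1 (r2 n)))) \<longlonglongrightarrow> y2 j"
    by (rule normalized_subsequence[OF fin(3) u[of "r1 _"], folded Nu_def]) (rule that; assumption)
  obtain r3 y3 where r3: "strict_mono r3" "\<exists>j\<in>J. y3 j \<noteq> 0"
    "\<And>j. j \<in> J \<Longrightarrow> (\<lambda>n. v (r1 (r2 (r3 n))) j / of_real (Nv (r1 (r2 (r3 n))))) \<longlonglongrightarrow> y3 j"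
    by (rule normalized_subsequence[OF fin(2) v[of "r1 (r2 _)"], folded Nv_def]) (rule that; assumption)
  define r where "r n = r1 (r2 (r3 n))" for n
  have lim1: "(\<lambda>n. e (r n) j / of_real (Ne (r n))) \<longlonglongrightarrow> y1 j" if "j \<in> I" for j
    using LIMSEQ_subseq_LIMSEQ[OF LIMSEQ_subseq_LIMSEQ[OF r1(3)[OF that] r2(1)] r3(1)]
    by (simp add: o_def r_def)
  have lim2: "(\<lambda>n. u (r n) j / of_real (Nu (r n))) \<longlonglongrightarrow> y2 j" if "j \<in> L" for j
    using LIMSEQ_subseq_LIMSEQ[OF r2(3)[OF that] r3(1)] by (simp add: o_def r_def)
  have lim3: "(\<lambda>n. v (r n) j / of_real (Nv (r n))) \<longlonglongrightarrow> y3 j" if "j \<in> J" for j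
    using r3(3)[OF that] by (simp add: r_def)
  have "strict_mono r"
    using strict_mono_o[OF strict_mono_o[OF r1(1) r2(1)] r3(1)] by (simp add: o_def r_def[abs_def])
  then have lim0: "(\<lambda>n. 1 / of_real (Ne (r n)) :: complex) \<longlonglongrightarrow> 0"
    using LIMSEQ_subseq_LIMSEQ[OF coefficient_norm_at_top[OF fin(1) large]]
    by (simp add: o_def Ne_def)
  let ?P = "comb I \<phi> y1" and ?U = "comb L f y2" and ?V = "comb J g y3"
  have prod0: "?U z * (?V z * deriv ?P z) = 0" if z: "z \<in> D" for z
  proof -
    have dc: "deriv (comb I \<phi> e) z = comb I (\<lambda>i. deriv (\<phi> i)) e z"
      "deriv (comb J g v) z = comb J (\<lambda>i. deriv (g i)) v z"
      "deriv (comb L f u) z = comb L (\<lambda>i. deriv (f i)) u z" for e v u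
      by (rule deriv_comb[OF _ D(1) z], erule hol)+
    define P where "P n = comb I (\<lambda>i. deriv (\<phi> i)) (\<lambda>i. e (r n) i / of_real (Ne (r n))) z" for n
    define U where "U n = comb L f (\<lambda>i. u (r n) i / of_real (Nu (r n))) z" for n
    define U' where "U' n = comb L (\<lambda>i. deriv (f i)) (\<lambda>i. u (r n) i / of_real (Nu (r n))) z" for n
    define V where "V n = comb J g (\<lambda>i. v (r n) i / of_real (Nv (r n))) z" for n
    define V' where "V' n = comb J (\<lambda>i. deriv (g i)) (\<lambda>i. v (r n) i / of_real (Nv (r n))) z" for n
    have "(\<lambda>n. 1 / of_real (Ne (r n)) * (V n * U' n - U n * V' n)) \<longlonglongrightarrow>
       0 * (?V z * comb L (\<lambda>i. deriv (f i)) y2 z - ?U z * comb J (\<lambda>i. deriv (g i)) y3 z)"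
      unfolding U_def U'_def V_def V'_def
      by (intro tendsto_intros tendsto_comb lim0 lim2 lim3)
    moreover have "1 / of_real (Ne (r n)) * (V n * U' n - U n * V' n) = U n * (V n * P n)" for n
    proof -
      have "comb J g (v (r n)) z * comb L (\<lambda>i. deriv (f i)) (u (r n)) z
          - comb L f (u (r n)) z * comb J (\<lambda>i. deriv (g i)) (v (r n)) z
        = comb J g (v (r n)) z * comb L f (u (r n)) z * comb I (\<lambda>i. deriv (\<phi> i)) (e (r n)) z"
        using bspec[OF ode[of "r n", unfolded ratio_ode_def] z] unfolding dc by simp
      then show ?thesis
        using pos[of "r n"] unfolding U_def U'_def V_def V'_def P_def comb_divide
        by (simp add: field_simps)
    qed
    ultimately have "(\<lambda>n. U n * (V n * P n)) \<longlonglongrightarrow> 0" by simp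
    moreover have "(\<lambda>n. U n * (V n * P n)) \<longlonglongrightarrow> ?U z * (?V z * deriv ?P z)"
      unfolding U_def V_def P_def dc by (intro tendsto_intros tendsto_comb lim1 lim2 lim3)
    ultimately show ?thesis using LIMSEQ_unique by blast
  qed
  have holP: "?P holomorphic_on D" "?U holomorphic_on D" "?V holomorphic_on D"
    by (intro holomorphic_comb hol; assumption)+
  have "?V z * deriv ?P z = 0" if "z \<in> D" for z
    using holomorphic_mult_eq_0[of ?U D "\<lambda>z. ?V z * deriv ?P z" z] prod0 holP D that
      lin_indep_comb[OF indep(3) r2(2)] holomorphic_deriv[OF holP(1) D(1)] holomorphic_on_mult by blast
  then have "deriv ?P z = 0" if "z \<in> D" for z
    using holomorphic_mult_eq_0[of ?V D "deriv ?P" z] holP D that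
      lin_indep_comb[OF indep(2) r3(2)] holomorphic_deriv[OF holP(1) D(1)] by blast
  then have "(?P has_field_derivative 0) (at z)" if "z \<in> D" for z
    using holomorphic_derivI[OF holP(1) D(1) that] that by simp
  then obtain c where "\<And>z. z \<in> D \<Longrightarrow> ?P z = c"
    using has_field_derivative_0_imp_constant_on[of D ?P] D unfolding constant_on_def
    by blast
  moreover have "?P 0 = 0" using zero by (simp add: comb_def)
  ultimately have "\<And>z. z \<in> D \<Longrightarrow> ?P z = 0" using D(3) by metis
  then show False using lin_indep_comb[OF indep(1) r1(2)] by blast
qed

section \<open>Zeros of \<open>1 + P\<close> and their consequences for the logarithm and
  powers\<close>

lemma uniform_limit_comb:
  assumes "finite I" "\<And>i. i \<in> I \<Longrightarrow> continuous_on K (x i)" "compact K"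
    and "\<And>i. i \<in> I \<Longrightarrow> (\<lambda>n. e n i) \<longlonglongrightarrow> y i"
  shows "uniform_limit K (\<lambda>n. comb I x (e n)) (comb I x y) sequentially"
  using assms
proof (induction I)
  case empty
  then show ?case using uniform_limit_const[of "\<lambda>_. 0 :: complex" K] by (simp add: comb_def[abs_def])
next
  case (insert i I)
  have "uniform_limit K (\<lambda>n z. e n i) (\<lambda>z. y i) sequentially"
  proof (rule uniform_limitI)
    fix \<epsilon> :: real assume "\<epsilon> > 0"
    then have "\<forall>\<^sub>F n in sequentially. dist (e n i) (y i) < \<epsilon>" using insert.prems by (simp add: tendstoD)
    then show "\<forall>\<^sub>F n in sequentially. \<forall>z\<in>K. dist (e n i) (y i) < \<epsilon>"
      by (rule eventually_mono) simp
  qed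
  moreover have "bounded (x i ` K)"
    using insert.prems by (intro compact_imp_bounded compact_continuous_image) auto
  ultimately have "uniform_limit K (\<lambda>n z. x i z * e n i) (\<lambda>z. x i z * y i) sequentially"
    by (intro uniform_lim_mult uniform_limit_const) (auto simp: image_constant_conv)
  moreover have "uniform_limit K (\<lambda>n. comb I x (e n)) (comb I x y) sequentially"
    using insert by blast
  ultimately have "uniform_limit K (\<lambda>n z. x i z * e n i + comb I x (e n) z)
      (\<lambda>z. x i z * y i + comb I x y z) sequentially"
    by (rule uniform_limit_add)
  then show ?case using insert.hyps by (simp add: comb_def[abs_def])
qed

text \<open>The normalized functions converge to a nonzero limit vanishing at \<open>0\<close>, so Hurwitz's theorem
  yields zeros near \<open>0\<close>.\<close>

lemma zero_of_specialization:
  assumes I: "finite I" and D: "open D" "connected D" "0 \<in> D"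
    and hol: "\<And>i. i \<in> I \<Longrightarrow> \<phi> i holomorphic_on D"
    and zero: "\<And>i. i \<in> I \<Longrightarrow> \<phi> i 0 = 0"
    and indep: "lin_indep_on D I \<phi>"
    and large: "\<And>n::nat. norm (comb I \<phi> (e n) z1) > real n"
  shows "\<exists>n. \<exists>z\<in>D. 1 + comb I \<phi> (e n) z = 0"
proof (rule ccontr)
  assume "\<not> ?thesis"
  then have nz: "1 + comb I \<phi> (e n) z \<noteq> 0" if "z \<in> D" for n z using that by blast
  have e: "\<exists>i\<in>I. e n i \<noteq> 0" for n
  proof (rule comb_nonzero)
    show "comb I \<phi> (e n) z1 \<noteq> 0" using large[of n] by auto
  qed
  define N where "N n = (\<Sum>i\<in>I. norm (e n i))" for n
  have pos: "N n > 0" for n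
    unfolding N_def by (intro sum_norm_pos I e)
  obtain r y where r: "strict_mono r" "\<exists>j\<in>I. y j \<noteq> 0"
    "\<And>j. j \<in> I \<Longrightarrow> (\<lambda>n. e (r n) j / of_real (N (r n))) \<longlonglongrightarrow> y j"
    by (rule normalized_subsequence[OF I e, folded N_def]) (rule that; assumption)
  have lim0: "(\<lambda>n. 1 / of_real (N (r n)) :: complex) \<longlonglongrightarrow> 0"
    using LIMSEQ_subseq_LIMSEQ[OF coefficient_norm_at_top[OF I large] r(1)]
    by (simp add: o_def N_def)
  \<comment> \<open>Dividing \<open>1 + P\<close> by the size of its coefficients keeps the zeros
    and removes the constant in the limit, so the limit does vanish at \<open>0\<close>.\<close>
  define F where "F n z = 1 / of_real (N (r n)) + comb I \<phi> (\<lambda>i. e (r n) i / of_real (N (r n))) z" for n z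
  have F: "F n z = (1 + comb I \<phi> (e (r n)) z) / of_real (N (r n))" for n z
    unfolding F_def comb_divide by (simp add: add_divide_distrib)
  have "comb I \<phi> y 0 \<noteq> 0"
  proof (rule Hurwitz_no_zeros[of D F "comb I \<phi> y"])
    show "F n holomorphic_on D" for n
      unfolding F_def[abs_def] by (intro holomorphic_intros holomorphic_comb hol)
    show "comb I \<phi> y holomorphic_on D" by (intro holomorphic_comb hol)
    show "F n z \<noteq> 0" if "z \<in> D" for n z using nz[OF that] pos[of "r n"] by (simp add: F)
    show "\<not> comb I \<phi> y constant_on D"
    proof
      assume "comb I \<phi> y constant_on D"
      moreover have "comb I \<phi> y 0 = 0" using zero by (simp add: comb_def)
      ultimately have "\<And>z. z \<in> D \<Longrightarrow> comb I \<phi> y z = 0" using D(3) unfolding constant_on_def by metis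
      then show False using lin_indep_comb[OF indep r(2)] by blast
    qed
    fix K assume K: "compact K" "K \<subseteq> D"
    have "uniform_limit K (\<lambda>n z. 1 / of_real (N (r n)) :: complex) (\<lambda>z. 0) sequentially"
    proof (rule uniform_limitI)
      fix \<epsilon> :: real assume "\<epsilon> > 0"
      then have "\<forall>\<^sub>F n in sequentially. dist (1 / of_real (N (r n)) :: complex) 0 < \<epsilon>"
        using lim0 by (simp only: tendstoD)
      then show "\<forall>\<^sub>F n in sequentially. \<forall>z\<in>K. dist (1 / of_real (N (r n)) :: complex) 0 < \<epsilon>"
        by (rule eventually_mono) simp
    qed
    moreover have "uniform_limit K (\<lambda>n. comb I \<phi> (\<lambda>i. e (r n) i / of_real (N (r n)))) (comb I \<phi> y) sequentially"
      using hol K r(3) by (intro uniform_limit_comb I)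
        (auto intro: holomorphic_on_imp_continuous_on holomorphic_on_subset)
    ultimately have "uniform_limit K (\<lambda>n z. 1 / of_real (N (r n)) +
        comb I \<phi> (\<lambda>i. e (r n) i / of_real (N (r n))) z) (\<lambda>z. 0 + comb I \<phi> y z) sequentially"
      by (rule uniform_limit_add)
    then show "uniform_limit K F (comb I \<phi> y) sequentially" by (simp add: F_def[abs_def])
  qed (use D in auto)
  moreover have "comb I \<phi> y 0 = 0" using zero by (simp add: comb_def)
  ultimately show False by simp
qed

text \<open>A single specialization with a zero of \<open>1 + P\<close> suffices. There
  \<open>order_comparison\<close> applies: \<open>1 + P\<close> has the value \<open>1\<close> at
  \<open>0\<close>, and \<open>U\<close>, \<open>V\<close> are not identically zero by
  independence.\<close>

lemma logarithmic_specializations: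
  assumes fin: "finite I" "finite J" "finite L" and D: "open D" "connected D" "0 \<in> D"
    and hol: "\<And>i. i \<in> I \<Longrightarrow> \<phi> i holomorphic_on D" "\<And>j. j \<in> J \<Longrightarrow> g j holomorphic_on D"
      "\<And>j. j \<in> L \<Longrightarrow> f j holomorphic_on D"
    and zero: "\<And>i. i \<in> I \<Longrightarrow> \<phi> i 0 = 0"
    and indep: "lin_indep_on D I \<phi>" "lin_indep_on D J g" "lin_indep_on D L f"
    and spec: "\<And>R. \<exists>e u v. norm (comb I \<phi> e z1) > R \<and> (\<exists>j\<in>L. u j \<noteq> 0) \<and> (\<exists>j\<in>J. v j \<noteq> 0) \<and>
       ratio_ode 1 1 c d D (comb I \<phi> e) (comb L f u) (comb J g v)"
  shows "d = 0 \<Longrightarrow> c = 0" and "c = 0 \<Longrightarrow> d \<in> \<rat>"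
proof -
  obtain e u v where large: "\<And>n::nat. norm (comb I \<phi> (e n) z1) > real n"
    and u: "\<And>n. \<exists>j\<in>L. u n j \<noteq> 0" and v: "\<And>n. \<exists>j\<in>J. v n j \<noteq> 0"
    and ode: "\<And>n. ratio_ode 1 1 c d D (comb I \<phi> (e n)) (comb L f (u n)) (comb J g (v n))"
  proof -
    have "\<forall>n::nat. \<exists>e u v. norm (comb I \<phi> e z1) > real n \<and> (\<exists>j\<in>L. u j \<noteq> 0) \<and> (\<exists>j\<in>J. v j \<noteq> 0) \<and>
       ratio_ode 1 1 c d D (comb I \<phi> e) (comb L f u) (comb J g v)" using spec by blast
    then show ?thesis using that by metis
  qed
  obtain n z0 where z0: "z0 \<in> D" "1 + comb I \<phi> (e n) z0 = 0"
    using zero_of_specialization[OF fin(1) D hol(1) zero indep(1) large] by blast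
  let ?F = "\<lambda>z. 1 + comb I \<phi> (e n) z"
  have holc: "comb I \<phi> (e n) holomorphic_on D" by (intro holomorphic_comb hol)
  have F: "?F holomorphic_on D" by (intro holomorphic_intros holc)
  have U: "comb L f (u n) holomorphic_on D" by (intro holomorphic_comb hol)
  have V: "comb J g (v n) holomorphic_on D" by (intro holomorphic_comb hol)
  have "?F 0 \<noteq> 0" using zero by (simp add: comb_def)
  then have nzF: "\<exists>z\<in>D. ?F z \<noteq> 0" using D(3) by blast
  have eq: "?F z * (comb J g (v n) z * deriv (comb L f (u n)) z - comb L f (u n) z * deriv (comb J g (v n)) z)
      = comb J g (v n) z * (c * comb J g (v n) z + d * comb L f (u n) z) * deriv ?F z" if "z \<in> D" for z
  proof -
    have "deriv ?F z = deriv (comb I \<phi> (e n)) z"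
      using holc D(1) that by (simp add: holomorphic_on_imp_differentiable_at)
    then show ?thesis using bspec[OF ode[of n, unfolded ratio_ode_def] that] by simp
  qed
  note oc = order_comparison[OF F U V D(1,2) z0 nzF lin_indep_comb[OF indep(3) u]
      lin_indep_comb[OF indep(2) v] eq]
  show "d = 0 \<Longrightarrow> c = 0" using oc(1) by blast
  show "c = 0 \<Longrightarrow> d \<in> \<rat>" using oc(2) by blast
qed

section \<open>Reduction to one variable\<close>

definition hermitian_sum :: "'i set \<Rightarrow> ('i \<Rightarrow> real) \<Rightarrow> ('i \<Rightarrow> 'z \<Rightarrow> complex) \<Rightarrow> 'z \<Rightarrow> real" where
  "hermitian_sum I r h z = (\<Sum>i\<in>I. r i * (cmod (h i z))\<^sup>2)"

text \<open>The cofactor of \<open>h i z\<close> in the polarized Hermitian sum. The two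
  conjugations make it holomorphic in \<open>w\<close>, and \<open>w = cnj z\<close> restores the
  Hermitian sum.\<close>

definition polarized_coeff :: "('i \<Rightarrow> real) \<Rightarrow> ('i \<Rightarrow> complex \<Rightarrow> complex) \<Rightarrow> complex \<Rightarrow> 'i \<Rightarrow> complex" where
  "polarized_coeff r h w i = of_real (r i) * cnj (h i (cnj w))"

lemma comb_polarized_diagonal:
  "comb I h (polarized_coeff r h (cnj z)) z = of_real (hermitian_sum I r h z)"
  unfolding comb_def polarized_coeff_def hermitian_sum_def of_real_sum of_real_mult complex_norm_square
  by (simp add: mult_ac)

lemma holomorphic_polarized_coeff:
  assumes "h i holomorphic_on ball 0 R"
  shows "(\<lambda>w. polarized_coeff r h w i) holomorphic_on ball 0 R"
proof -
  have "cnj ` ball 0 R = ball 0 R"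
  proof
    show "ball 0 R \<subseteq> cnj ` ball 0 R"
    proof
      fix x :: complex assume "x \<in> ball 0 R"
      then have "x = cnj (cnj x)" "cnj x \<in> ball 0 R" by auto
      then show "x \<in> cnj ` ball 0 R" by blast
    qed
  qed auto
  then have "(cnj \<circ> h i \<circ> cnj) holomorphic_on ball 0 R"
    using assms by (intro holomorphic_on_compose_cnj_cnj) auto
  then show ?thesis
    unfolding polarized_coeff_def by (intro holomorphic_intros) (simp add: o_def)
qed

lemma holomorphic_affine:
  assumes "f holomorphic_on ball 0 (2 * e)" "norm a = 1" "norm c < e"
  shows "(\<lambda>x. f (a * x + c)) holomorphic_on ball 0 e"
proof -
  have "norm (a * x + c) < 2 * e" if "norm x < e" for x
    using norm_triangle_ineq[of "a * x" c] that assms(2,3) by (simp add: norm_mult)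
  then have "(\<lambda>x. a * x + c) ` ball 0 e \<subseteq> ball 0 (2 * e)" by auto
  moreover have "(\<lambda>x. a * x + c) holomorphic_on ball 0 e" by (intro holomorphic_intros)
  ultimately have "(f \<circ> (\<lambda>x. a * x + c)) holomorphic_on ball 0 e"
    using assms(1) holomorphic_on_compose_gen by blast
  then show ?thesis by (simp add: o_def)
qed

text \<open>\<open>\<E>\<close> extends \<open>E\<close> holomorphically to the unit disc, and its
  linear equation covers the three cases together. The bound keeps the kernel \<open>P\<close> in
  this disc; the radius \<open>2 * e\<close> is halved by \<open>polarization\<close>. Since
  \<open>E\<close> is nonzero off \<open>0\<close>, \<open>U\<close> is nonzero at \<open>z1\<close>
  because \<open>V\<close> and \<open>P\<close> are.\<close>

lemma kernel_constants:
  fixes h :: "'i \<Rightarrow> complex \<Rightarrow> complex" and g :: "'j \<Rightarrow> complex \<Rightarrow> complex" and f :: "'l \<Rightarrow> complex \<Rightarrow> complex"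
    and \<E> :: "complex \<Rightarrow> complex" and E :: "real \<Rightarrow> real"
  assumes fin: "finite I" "finite J" "finite L" and e: "e > 0"
    and hol: "\<And>i. i \<in> I \<Longrightarrow> h i holomorphic_on ball 0 (2 * e)"
      "\<And>j. j \<in> J \<Longrightarrow> g j holomorphic_on ball 0 (2 * e)"
      "\<And>j. j \<in> L \<Longrightarrow> f j holomorphic_on ball 0 (2 * e)"
    and zero: "\<And>i. i \<in> I \<Longrightarrow> h i 0 = 0"
    and bound: "\<And>i z. i \<in> I \<Longrightarrow> norm z < 2 * e \<Longrightarrow> norm (h i z) \<le> B" "(\<Sum>i\<in>I. \<bar>r i\<bar>) * B\<^sup>2 < 1"
    and \<E>: "\<E> holomorphic_on ball 0 1" "\<And>x. norm x < 1 \<Longrightarrow> (a + b * x) * deriv \<E> x = c + d * \<E> x"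
    and E: "\<And>x. \<bar>x\<bar> < 1 \<Longrightarrow> \<E> (of_real x) = of_real (E x)" "\<And>x. \<bar>x\<bar> < 1 \<Longrightarrow> x \<noteq> 0 \<Longrightarrow> E x \<noteq> 0"
    and eq: "\<And>z. norm z < 2 * e \<Longrightarrow> hermitian_sum J p g z * E (hermitian_sum I r h z) = hermitian_sum L q f z"
    and pt: "norm z1 < e" "hermitian_sum J p g z1 \<noteq> 0" "hermitian_sum I r h z1 \<noteq> 0"
  shows "\<not> (a = 1 \<and> b = 0 \<and> c = 0 \<and> d = 1)"
    and "a = 1 \<Longrightarrow> b = 1 \<Longrightarrow> d = 0 \<Longrightarrow> c = 0"
    and "a = 1 \<Longrightarrow> b = 1 \<Longrightarrow> c = 0 \<Longrightarrow> d \<in> \<rat>"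
proof -
  define D where "D = ball (0::complex) e"
  have D: "open D" "connected D" "0 \<in> D" using e by (auto simp: D_def)
  have sub: "D \<subseteq> ball 0 (2 * e)" using e by (auto simp: D_def)
  let ?P = "\<lambda>w. comb I h (polarized_coeff r h w)"
  let ?V = "\<lambda>w. comb J g (polarized_coeff p g w)"
  let ?U = "\<lambda>w. comb L f (polarized_coeff q f w)"
  have small: "norm (?P w z) < 1" if "norm z < 2 * e" "norm w < 2 * e" for z w
  proof -
    have "norm (?P w z) \<le> (\<Sum>i\<in>I. \<bar>r i\<bar> * B\<^sup>2)"
      unfolding comb_def polarized_coeff_def
    proof (rule sum_norm_le)
      fix i assume i: "i \<in> I"
      have "norm (h i z) \<le> B" "norm (h i (cnj w)) \<le> B" using bound(1)[OF i] that by auto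
      then have "norm (h i z) * norm (h i (cnj w)) \<le> B * B"
        by (intro mult_mono) (auto intro: order_trans[OF norm_ge_zero])
      then have "\<bar>r i\<bar> * (norm (h i z) * norm (h i (cnj w))) \<le> \<bar>r i\<bar> * B\<^sup>2"
        by (intro mult_left_mono) (auto simp: power2_eq_square)
      then show "norm (h i z * (of_real (r i) * cnj (h i (cnj w)))) \<le> \<bar>r i\<bar> * B\<^sup>2"
        by (simp add: norm_mult mult_ac)
    qed
    also have "\<dots> = (\<Sum>i\<in>I. \<bar>r i\<bar>) * B\<^sup>2" by (simp add: sum_distrib_right)
    finally show ?thesis using bound(2) by simp
  qed
  have polar: "?V w z * \<E> (?P w z) - ?U w z = 0" if "norm z < e" "norm w < e" for z w
  proof (rule polarization[of e "\<lambda>z w. ?V w z * \<E> (?P w z) - ?U w z"])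
    fix z :: complex assume z: "norm z < 2 * e"
    have s: "\<bar>hermitian_sum I r h z\<bar> < 1"
      using small[OF z, of "cnj z"] z unfolding comb_polarized_diagonal norm_of_real by simp
    show "?V (cnj z) z * \<E> (?P (cnj z) z) - ?U (cnj z) z = 0"
      unfolding comb_polarized_diagonal E(1)[OF s] eq[OF z, symmetric] by simp
  next
    fix a b c d :: complex
    assume *: "a \<in> {1, \<i>}" "b \<in> {1, - \<i>}" "norm c < e" "norm d < e"
    have ab: "norm a = 1" "norm b = 1" using * by auto
    have aff: "(\<lambda>x. comb S y (polarized_coeff t y (b * x + d)) (a * x + c)) holomorphic_on ball 0 e"
      if "\<And>i. i \<in> S \<Longrightarrow> y i holomorphic_on ball 0 (2 * e)" for S t and y :: "'s \<Rightarrow> complex \<Rightarrow> complex"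
      unfolding comb_def
      by (intro holomorphic_intros holomorphic_affine[OF _ ab(1) *(3)]
          holomorphic_affine[OF _ ab(2) *(4)] holomorphic_polarized_coeff that)
    have in1: "norm (a * x + c) < 2 * e" "norm (b * x + d) < 2 * e" if "norm x < e" for x
      using norm_triangle_ineq[of "a * x" c] norm_triangle_ineq[of "b * x" d] that * ab
      by (auto simp: norm_mult)
    have "(\<lambda>x. ?P (b * x + d) (a * x + c)) ` ball 0 e \<subseteq> ball 0 1"
      using small in1 by auto
    then have "(\<E> \<circ> (\<lambda>x. ?P (b * x + d) (a * x + c))) holomorphic_on ball 0 e"
      using aff[of I h r] hol(1) \<E>(1) holomorphic_on_compose_gen by blast
    then show "(\<lambda>x. ?V (b * x + d) (a * x + c) * \<E> (?P (b * x + d) (a * x + c)) - ?U (b * x + d) (a * x + c))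
      holomorphic_on ball 0 e"
      by (intro holomorphic_intros aff hol) (simp_all add: o_def)
  qed (use that e in auto)
  have hol_sub: "\<And>i. i \<in> I \<Longrightarrow> h i holomorphic_on D" "\<And>j. j \<in> J \<Longrightarrow> g j holomorphic_on D"
    "\<And>j. j \<in> L \<Longrightarrow> f j holomorphic_on D"
    using hol sub holomorphic_on_subset by blast+
  have hol_sub': "\<And>i. i \<in> I \<Longrightarrow> (\<lambda>w. polarized_coeff r h w i) holomorphic_on D"
    "\<And>j. j \<in> J \<Longrightarrow> (\<lambda>w. polarized_coeff p g w j) holomorphic_on D"
    "\<And>j. j \<in> L \<Longrightarrow> (\<lambda>w. polarized_coeff q f w j) holomorphic_on D"
    by (rule holomorphic_on_subset[OF holomorphic_polarized_coeff sub], erule hol)+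
  \<comment> \<open>Differentiate \<open>U = V * \<E>(P)\<close> in \<open>z\<close>; after
    multiplication by \<open>a + b * P\<close> the derivative of \<open>\<E>\<close> is eliminated
    by its equation, and \<open>V * \<E>(P)\<close> is read as \<open>U\<close> again.\<close>
  have ode: "ratio_ode a b c d D (?P w) (?U w) (?V w)" if w: "w \<in> D" for w
    unfolding ratio_ode_def
  proof
    fix z assume z: "z \<in> D"
    have zw: "norm z < e" "norm w < e" using z w by (auto simp: D_def)
    have s: "norm (?P w z) < 1" using small zw e by simp
    have UV: "?U w y = ?V w y * \<E> (?P w y)" if "y \<in> D" for y
      using polar[of y w] that zw by (simp add: D_def)
    have dP: "(?P w has_field_derivative deriv (?P w) z) (at z)"
      by (rule holomorphic_derivI[OF holomorphic_comb D(1) z]) (rule hol_sub)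
    have dV: "(?V w has_field_derivative deriv (?V w) z) (at z)"
      by (rule holomorphic_derivI[OF holomorphic_comb D(1) z]) (rule hol_sub)
    have "(\<E> has_field_derivative deriv \<E> (?P w z)) (at (?P w z))"
      using s by (intro holomorphic_derivI[OF \<E>(1) open_ball]) simp
    from DERIV_mult[OF dV DERIV_chain2[OF this dP]]
    have "((\<lambda>y. ?V w y * \<E> (?P w y)) has_field_derivative
        deriv (?V w) z * \<E> (?P w z) + (deriv \<E> (?P w z) * deriv (?P w) z) * ?V w z) (at z)" .
    then have "(?U w has_field_derivative
        deriv (?V w) z * \<E> (?P w z) + (deriv \<E> (?P w z) * deriv (?P w) z) * ?V w z) (at z)"
      by (rule has_field_derivative_transform_within_open[OF _ D(1) z]) (simp add: UV)
    then have dU: "deriv (?U w) z =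
        deriv (?V w) z * \<E> (?P w z) + (deriv \<E> (?P w z) * deriv (?P w) z) * ?V w z"
      by (rule DERIV_imp_deriv)
    have "(a + b * ?P w z) * (?V w z * deriv (?U w) z - ?U w z * deriv (?V w) z)
      = ?V w z * ?V w z * ((a + b * ?P w z) * deriv \<E> (?P w z)) * deriv (?P w) z"
      unfolding dU UV[OF z] by (simp add: algebra_simps)
    also have "\<dots> = ?V w z * (c * ?V w z + d * ?U w z) * deriv (?P w) z"
      unfolding \<E>(2)[OF s] UV[OF z] by (simp add: algebra_simps)
    finally show "(a + b * ?P w z) * (?V w z * deriv (?U w) z - ?U w z * deriv (?V w) z)
      = ?V w z * (c * ?V w z + d * ?U w z) * deriv (?P w) z" .
  qed
  have z1: "z1 \<in> D" "cnj z1 \<in> D" using pt(1) by (auto simp: D_def)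
  have n0: "?P (cnj z1) z1 \<noteq> 0" "?V (cnj z1) z1 \<noteq> 0"
    unfolding comb_polarized_diagonal using pt by auto
  have "\<bar>hermitian_sum I r h z1\<bar> < 1"
    using small[of z1 "cnj z1"] pt(1) e unfolding comb_polarized_diagonal norm_of_real by simp
  then have "hermitian_sum L q f z1 \<noteq> 0" using eq[of z1] E(2) pt e by auto
  then have n1: "?U (cnj z1) z1 \<noteq> 0" unfolding comb_polarized_diagonal by auto
  have zero': "polarized_coeff r h 0 i = 0" if "i \<in> I" for i
    using zero[OF that] by (simp add: polarized_coeff_def)
  obtain I' J' L' where S: "I' \<subseteq> I" "J' \<subseteq> J" "L' \<subseteq> L"
    and indep: "lin_indep_on D I' h" "lin_indep_on D J' g" "lin_indep_on D L' f"
    and spec: "\<And>R. \<exists>e u v. norm (comb I' h e z1) > R \<and> (\<exists>j\<in>L'. u j \<noteq> 0) \<and> (\<exists>j\<in>J'. v j \<noteq> 0) \<and>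
       ratio_ode a b c d D (comb I' h e) (comb L' f u) (comb J' g v)"
    by (rule specializations_exist[OF fin D hol_sub hol_sub' zero' ode z1 n0(1) n1 n0(2)]) blast+
  have fin': "finite I'" "finite J'" "finite L'" using S fin finite_subset by blast+
  have hol'': "\<And>i. i \<in> I' \<Longrightarrow> h i holomorphic_on D" "\<And>j. j \<in> J' \<Longrightarrow> g j holomorphic_on D"
    "\<And>j. j \<in> L' \<Longrightarrow> f j holomorphic_on D" using S hol_sub by blast+
  have zero'': "\<And>i. i \<in> I' \<Longrightarrow> h i 0 = 0" using S zero by blast
  show "\<not> (a = 1 \<and> b = 0 \<and> c = 0 \<and> d = 1)"
    using no_exponential_specializations[OF fin' D hol'' zero'' indep, of z1] spec by blast
  show "d = 0 \<Longrightarrow> c = 0" if "a = 1" "b = 1"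
    using logarithmic_specializations(1)[OF fin' D hol'' zero'' indep, of z1 c d] spec that by blast
  show "c = 0 \<Longrightarrow> d \<in> \<rat>" if "a = 1" "b = 1"
    using logarithmic_specializations(2)[OF fin' D hol'' zero'' indep, of z1 c d] spec that by blast
qed

section \<open>Restriction from several variables to complex lines\<close>

lemma norm_vector_smult_complex: "norm ((c::complex) *s (v :: complex ^ 'n)) = norm c * norm v"
  unfolding norm_vec_def vector_scalar_mult_def
  by (simp add: vector_smult_component norm_mult L2_set_right_distrib)

text \<open>By complex linearity the derivative along the line is multiplication by
  \<open>F v\<close>.\<close>

lemma holomorphic_vec_on_line:
  assumes f: "holomorphic_vec_on f S" and T: "\<And>\<zeta>. \<zeta> \<in> T \<Longrightarrow> x + \<zeta> *s v \<in> S"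
  shows "(\<lambda>\<zeta>. f (x + \<zeta> *s v)) holomorphic_on T"
  unfolding holomorphic_on_def
proof
  fix \<zeta> assume \<zeta>: "\<zeta> \<in> T"
  obtain F where F: "(f has_derivative F) (at (x + \<zeta> *s v))" "\<And>c v. F (c *s v) = c * F v"
    using f T[OF \<zeta>] unfolding holomorphic_vec_on_def by blast
  have "bounded_linear (\<lambda>\<zeta>::complex. \<zeta> *s v)"
  proof (rule bounded_linear_intro[where K = "norm v"])
    show "(c + d) *s v = c *s v + d *s v" for c d by (simp add: vec_eq_iff distrib_right)
    show "(t *\<^sub>R c) *s v = t *\<^sub>R (c *s v)" for t c
      by (simp add: vec_eq_iff)
    show "norm (c *s v) \<le> norm c * norm v" for c by (simp add: norm_vector_smult_complex)
  qed
  then have "((\<lambda>\<zeta>. \<zeta> *s v) has_derivative (\<lambda>\<zeta>. \<zeta> *s v)) (at \<zeta>)"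
    by (rule bounded_linear_imp_has_derivative)
  then have "((\<lambda>\<zeta>. x + \<zeta> *s v) has_derivative (\<lambda>\<zeta>. \<zeta> *s v)) (at \<zeta>)"
    by (auto intro!: derivative_eq_intros)
  from has_derivative_compose[OF this F(1)]
  have "((\<lambda>\<zeta>. f (x + \<zeta> *s v)) has_derivative (\<lambda>\<zeta>. F v * \<zeta>)) (at \<zeta>)"
    by (simp add: F(2) mult.commute)
  then have "((\<lambda>\<zeta>. f (x + \<zeta> *s v)) has_field_derivative F v) (at \<zeta>)"
    by (simp add: has_field_derivative_def)
  then show "(\<lambda>\<zeta>. f (x + \<zeta> *s v)) field_differentiable at \<zeta> within T"
    using field_differentiable_def field_differentiable_at_within by blast
qed

text \<open>On the reals a Hermitian sum is the restriction of the holomorphic function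
  \<open>\<zeta> \<mapsto> \<Sum> r h(\<zeta>) cnj (h (cnj \<zeta>))\<close>, whence an identity theorem along segments.\<close>

lemma common_nonzero_point:
  assumes R: "R > 1"
    and hol: "\<And>i. i \<in> I \<Longrightarrow> h i holomorphic_on ball 0 R" "\<And>j. j \<in> J \<Longrightarrow> g j holomorphic_on ball 0 R"
    and nz: "hermitian_sum J p g 0 \<noteq> 0" "hermitian_sum I r h 1 \<noteq> 0"
  obtains t :: real where "\<bar>t\<bar> < R" "hermitian_sum J p g (of_real t) \<noteq> 0"
    "hermitian_sum I r h (of_real t) \<noteq> 0"
proof (rule ccontr)
  assume "\<not> thesis"
  then have no: "hermitian_sum J p g (of_real t) = 0 \<or> hermitian_sum I r h (of_real t) = 0"
    if "\<bar>t\<bar> < R" for t :: real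
    using \<open>\<And>t. \<bar>t\<bar> < R \<Longrightarrow> hermitian_sum J p g (of_real t) \<noteq> 0 \<Longrightarrow>
      hermitian_sum I r h (of_real t) \<noteq> 0 \<Longrightarrow> thesis\<close> that by blast
  let ?P = "\<lambda>x. comb I h (polarized_coeff r h x) x" and ?V = "\<lambda>x. comb J g (polarized_coeff p g x) x"
  have real: "?P (of_real t) = of_real (hermitian_sum I r h (of_real t))"
    "?V (of_real t) = of_real (hermitian_sum J p g (of_real t))" for t
    using comb_polarized_diagonal[of _ _ _ "of_real t :: complex"] by simp_all
  have holP: "?P holomorphic_on ball 0 R" "?V holomorphic_on ball 0 R"
    unfolding comb_def by (intro holomorphic_intros hol holomorphic_polarized_coeff; assumption)+
  \<comment> \<open>The product vanishes on the reals, hence on the disc; as \<open>?V\<close> is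
    not identically zero, \<open>?P\<close> is, also at \<open>1\<close>.\<close>
  have "?V x * ?P x = 0" if "x \<in> ball 0 R" for x
  proof (rule holomorphic_zero_on_reals[of "\<lambda>x. ?V x * ?P x" R])
    show "(\<lambda>x. ?V x * ?P x) holomorphic_on ball 0 R" by (intro holomorphic_intros holP)
    fix t :: real assume "\<bar>t\<bar> < R"
    then show "?V (of_real t) * ?P (of_real t) = 0" unfolding real using no[of t] by auto
  qed (use that R in auto)
  moreover have "\<exists>x\<in>ball 0 R. ?V x \<noteq> 0"
    using nz(1) real(2)[of 0] R by (intro bexI[of _ 0]) auto
  moreover have "1 \<in> ball (0::complex) R" using R by simp
  ultimately have "?P 1 = 0"
    using holomorphic_mult_eq_0[OF holP(2,1) open_ball connected_ball] by blast
  then show False using nz(2) real(1)[of 1] by simp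
qed

text \<open>The line through \<open>x\<close> has to contain a point where both Hermitian sums are
  nonzero. The points \<open>y1\<close> and \<open>y2\<close> serve one sum each; the line joining
  them contains a common point \<open>y\<close>, which then determines the line through
  \<open>x\<close>, with parameter \<open>1\<close> at \<open>y\<close>.\<close>

lemma vector_kernel_constants:
  fixes h :: "'i \<Rightarrow> complex ^ 'n \<Rightarrow> complex" and g :: "'j \<Rightarrow> complex ^ 'n \<Rightarrow> complex"
    and f :: "'l \<Rightarrow> complex ^ 'n \<Rightarrow> complex" and \<E> :: "complex \<Rightarrow> complex" and E :: "real \<Rightarrow> real"
  assumes fin: "finite I" "finite J" "finite L" and \<epsilon>: "\<epsilon> > 0"
    and hol: "\<And>i. i \<in> I \<Longrightarrow> holomorphic_vec_on (h i) (ball x \<epsilon>)"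
      "\<And>j. j \<in> J \<Longrightarrow> holomorphic_vec_on (g j) (ball x \<epsilon>)"
      "\<And>j. j \<in> L \<Longrightarrow> holomorphic_vec_on (f j) (ball x \<epsilon>)"
    and zero: "\<And>i. i \<in> I \<Longrightarrow> h i x = 0"
    and bound: "\<And>i y. i \<in> I \<Longrightarrow> y \<in> ball x \<epsilon> \<Longrightarrow> norm (h i y) \<le> B" "(\<Sum>i\<in>I. \<bar>r i\<bar>) * B\<^sup>2 < 1"
    and \<E>: "\<E> holomorphic_on ball 0 1" "\<And>x. norm x < 1 \<Longrightarrow> (a + b * x) * deriv \<E> x = c + d * \<E> x"
    and E: "\<And>x. \<bar>x\<bar> < 1 \<Longrightarrow> \<E> (of_real x) = of_real (E x)" "\<And>x. \<bar>x\<bar> < 1 \<Longrightarrow> x \<noteq> 0 \<Longrightarrow> E x \<noteq> 0"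
    and eq: "\<And>y. y \<in> ball x \<epsilon> \<Longrightarrow>
      hermitian_sum J p g y * E (hermitian_sum I r h y) = hermitian_sum L q f y"
    and nz: "\<not> (\<forall>\<^sub>F y in nhds x. hermitian_sum J p g y = 0)"
      "\<not> (\<forall>\<^sub>F y in nhds x. hermitian_sum I r h y = 0)"
  shows "\<not> (a = 1 \<and> b = 0 \<and> c = 0 \<and> d = 1)"
    and "a = 1 \<Longrightarrow> b = 1 \<Longrightarrow> d = 0 \<Longrightarrow> c = 0"
    and "a = 1 \<Longrightarrow> b = 1 \<Longrightarrow> c = 0 \<Longrightarrow> d \<in> \<rat>"
proof -
  \<comment> \<open>The radius is chosen so that the disc of radius \<open>2\<close> on the joining
    line stays within \<open>\<epsilon> / 4\<close> of \<open>x\<close>; then the disc of radius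
    \<open>4 = 2 * 2\<close> on the line through \<open>x\<close> and \<open>y\<close> stays in the
    \<open>\<epsilon>\<close>-ball.\<close>
  have near: "\<exists>y\<in>ball x (\<epsilon> / 32). F y \<noteq> 0" if "\<not> (\<forall>\<^sub>F y in nhds x. F y = (0::real))" for F
  proof (rule ccontr)
    assume "\<not> ?thesis"
    then have "\<forall>\<^sub>F y in nhds x. F y = 0"
      using \<epsilon> eventually_nhds_in_open[of "ball x (\<epsilon> / 32)" x] by (auto elim: eventually_mono)
    then show False using that by blast
  qed
  obtain y1 where y1: "y1 \<in> ball x (\<epsilon> / 32)" "hermitian_sum J p g y1 \<noteq> 0" using near[OF nz(1)] by blast
  obtain y2 where y2: "y2 \<in> ball x (\<epsilon> / 32)" "hermitian_sum I r h y2 \<noteq> 0" using near[OF nz(2)] by blast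
  have d12: "norm (y1 - x) < \<epsilon> / 32" "norm (y2 - y1) < \<epsilon> / 16"
    using y1(1) y2(1) norm_triangle_ineq4[of "y2 - x" "y1 - x"] by (auto simp: dist_norm norm_minus_commute)
  have line: "norm (y1 + \<zeta> *s (y2 - y1) - x) < \<epsilon> / 4" if "norm \<zeta> < 2" for \<zeta>
  proof -
    have "norm (\<zeta> *s (y2 - y1)) \<le> 2 * norm (y2 - y1)"
      unfolding norm_vector_smult_complex using that by (intro mult_right_mono) auto
    moreover have "y1 + \<zeta> *s (y2 - y1) - x = (y1 - x) + \<zeta> *s (y2 - y1)" by simp
    ultimately show ?thesis
      using d12 \<epsilon> norm_triangle_ineq[of "y1 - x" "\<zeta> *s (y2 - y1)"] by (simp only:)
  qed
  have in_ball: "y1 + \<zeta> *s (y2 - y1) \<in> ball x \<epsilon>" if "\<zeta> \<in> ball 0 2" for \<zeta>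
    using line[of \<zeta>] that \<epsilon> by (simp add: dist_norm norm_minus_commute)
  have hol_line: "(\<lambda>\<zeta>. h i (y1 + \<zeta> *s (y2 - y1))) holomorphic_on ball 0 2" if "i \<in> I" for i
    using holomorphic_vec_on_line[OF hol(1)[OF that] in_ball] .
  have hol_line': "(\<lambda>\<zeta>. g i (y1 + \<zeta> *s (y2 - y1))) holomorphic_on ball 0 2" if "i \<in> J" for i
    using holomorphic_vec_on_line[OF hol(2)[OF that] in_ball] .
  have nz_line: "hermitian_sum J p (\<lambda>j \<zeta>. g j (y1 + \<zeta> *s (y2 - y1))) 0 \<noteq> 0"
    using y1(2) by (simp add: hermitian_sum_def)
  have nz_line': "hermitian_sum I r (\<lambda>j \<zeta>. h j (y1 + \<zeta> *s (y2 - y1))) 1 \<noteq> 0"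
    using y2(2) by (simp add: hermitian_sum_def)
  obtain t where t: "\<bar>t\<bar> < 2"
    "hermitian_sum J p (\<lambda>j \<zeta>. g j (y1 + \<zeta> *s (y2 - y1))) (of_real t) \<noteq> 0"
    "hermitian_sum I r (\<lambda>j \<zeta>. h j (y1 + \<zeta> *s (y2 - y1))) (of_real t) \<noteq> 0"
    by (rule common_nonzero_point[OF _ hol_line hol_line' nz_line nz_line']) (simp, blast+)
  define y where "y = y1 + of_real t *s (y2 - y1)"
  have y: "norm (y - x) < \<epsilon> / 4" "hermitian_sum J p g y \<noteq> 0" "hermitian_sum I r h y \<noteq> 0"
    subgoal using t(1) line[of "of_real t"] by (simp only: y_def norm_of_real)
    subgoal using t(2) unfolding y_def hermitian_sum_def .
    subgoal using t(3) unfolding y_def hermitian_sum_def .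
    done
  have in_ball': "x + \<zeta> *s (y - x) \<in> ball x \<epsilon>" if "norm \<zeta> < 2 * 2" for \<zeta>
  proof -
    have "norm (\<zeta> *s (y - x)) \<le> 4 * norm (y - x)"
      unfolding norm_vector_smult_complex using that by (intro mult_right_mono) auto
    moreover have "dist x (x + \<zeta> *s (y - x)) = norm (\<zeta> *s (y - x))"
      unfolding dist_norm by (metis add_diff_cancel_left' norm_minus_commute)
    ultimately show ?thesis using y(1) by (simp only: mem_ball)
  qed
  have hol': "\<And>i. i \<in> I \<Longrightarrow> (\<lambda>\<zeta>. h i (x + \<zeta> *s (y - x))) holomorphic_on ball 0 (2 * 2)"
      "\<And>j. j \<in> J \<Longrightarrow> (\<lambda>\<zeta>. g j (x + \<zeta> *s (y - x))) holomorphic_on ball 0 (2 * 2)"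
      "\<And>j. j \<in> L \<Longrightarrow> (\<lambda>\<zeta>. f j (x + \<zeta> *s (y - x))) holomorphic_on ball 0 (2 * 2)"
    by (rule holomorphic_vec_on_line, erule hol, rule in_ball', simp)+
  have zero': "h i (x + 0 *s (y - x)) = 0" if "i \<in> I" for i using zero[OF that] by simp
  have bound': "norm (h i (x + \<zeta> *s (y - x))) \<le> B" if "i \<in> I" "norm \<zeta> < 2 * 2" for i \<zeta>
    using bound(1) in_ball' that by blast
  have eq': "hermitian_sum J p (\<lambda>j \<zeta>. g j (x + \<zeta> *s (y - x))) \<zeta> *
      E (hermitian_sum I r (\<lambda>j \<zeta>. h j (x + \<zeta> *s (y - x))) \<zeta>)
      = hermitian_sum L q (\<lambda>j \<zeta>. f j (x + \<zeta> *s (y - x))) \<zeta>" if "norm \<zeta> < 2 * 2" for \<zeta>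
    unfolding hermitian_sum_def using eq[OF in_ball'[OF that], unfolded hermitian_sum_def] .
  have pt: "norm (1::complex) < 2" "hermitian_sum J p (\<lambda>j \<zeta>. g j (x + \<zeta> *s (y - x))) 1 \<noteq> 0"
    "hermitian_sum I r (\<lambda>j \<zeta>. h j (x + \<zeta> *s (y - x))) 1 \<noteq> 0"
    using y by (simp_all add: hermitian_sum_def)
  note kc = kernel_constants[OF fin zero_less_numeral hol' zero' bound' bound(2) \<E> E eq' pt]
  show "\<not> (a = 1 \<and> b = 0 \<and> c = 0 \<and> d = 1)" using kc(1) by blast
  show "a = 1 \<Longrightarrow> b = 1 \<Longrightarrow> d = 0 \<Longrightarrow> c = 0" using kc(2) by blast
  show "a = 1 \<Longrightarrow> b = 1 \<Longrightarrow> c = 0 \<Longrightarrow> d \<in> \<rat>" using kc(3) by blast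
qed

section \<open>Germs on complex manifolds\<close>

text \<open>A chart is a homeomorphism between open sets, so every germ statement at
  \<open>p\<close> can be moved into coordinates.\<close>

lemma eventually_nhdsin_chart:
  assumes X: "complex_manifold M A" and chart: "(U, \<psi>) \<in> A" and p: "p \<in> U"
  shows "eventually P (nhdsin M p) \<longleftrightarrow> eventually (\<lambda>y. P (inv_into U \<psi> y)) (nhds (\<psi> p))"
proof -
  interpret complex_manifold M A by (rule X)
  have U: "openin M U" and img: "open (\<psi> ` U)"
    and homeo: "homeomorphic_map (subtopology M U) (top_of_set (\<psi> ` U)) \<psi>"
    using chart chart_dom chart_img chart_homeo by blast+
  have UM: "U \<subseteq> topspace M" using U openin_subset by blast
  then have top: "topspace (subtopology M U) = U" by (simp add: inf.absorb2)
  have inj: "inj_on \<psi> U" using homeo top unfolding homeomorphic_eq_everything_map by simp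
  have inv: "inv_into U \<psi> (\<psi> x) = x" if "x \<in> U" for x using inj that by simp
  have pM: "p \<in> topspace M" using p UM by blast
  show ?thesis
  proof
    assume "eventually P (nhdsin M p)"
    then obtain S where S: "openin M S" "p \<in> S" "\<And>x. x \<in> S \<Longrightarrow> P x"
      unfolding eventually_nhdsin using pM by blast
    have "openin (subtopology M U) (U \<inter> S)" using S(1) by (simp add: openin_subtopology_Int2)
    then have "openin (top_of_set (\<psi> ` U)) (\<psi> ` (U \<inter> S))"
      using homeo unfolding homeomorphic_eq_everything_map open_map_def by blast
    then have "open (\<psi> ` (U \<inter> S))" using img openin_open_eq by blast
    moreover have "\<psi> p \<in> \<psi> ` (U \<inter> S)" using p S by blast
    moreover have "P (inv_into U \<psi> y)" if "y \<in> \<psi> ` (U \<inter> S)" for y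
      using that S(3) inv by auto
    ultimately show "\<forall>\<^sub>F y in nhds (\<psi> p). P (inv_into U \<psi> y)"
      unfolding eventually_nhds by blast
  next
    assume "\<forall>\<^sub>F y in nhds (\<psi> p). P (inv_into U \<psi> y)"
    then obtain T where T: "open T" "\<psi> p \<in> T" "\<And>y. y \<in> T \<Longrightarrow> P (inv_into U \<psi> y)"
      unfolding eventually_nhds by blast
    have "openin (top_of_set (\<psi> ` U)) (\<psi> ` U \<inter> T)" using T(1) by (simp add: openin_open_Int)
    then have "openin (subtopology M U) {x \<in> topspace (subtopology M U). \<psi> x \<in> \<psi> ` U \<inter> T}"
      using homeo unfolding homeomorphic_eq_everything_map
      by (blast intro: openin_continuous_map_preimage)
    then have "openin M {x \<in> U. \<psi> x \<in> \<psi> ` U \<inter> T}"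
      unfolding top using U openin_trans_full by blast
    moreover have "P x" if "x \<in> {x \<in> U. \<psi> x \<in> \<psi> ` U \<inter> T}" for x
      using that T(3)[of "\<psi> x"] inv by auto
    ultimately show "eventually P (nhdsin M p)"
      unfolding eventually_nhdsin using p T(2) by blast
  qed
qed

text \<open>Holomorphy is pointwise in \<open>holomorphic_vec_on\<close>, so singletons allow it to
  be stated as an eventual property, to be combined with the other finitely many conditions near the
  point.\<close>

lemma holomorphic_near_chart:
  assumes X: "complex_manifold M A" and chart: "(U, \<psi>) \<in> A" and p: "p \<in> U"
    and f: "holomorphic_near M A p f"
  shows "\<forall>\<^sub>F y in nhds (\<psi> p). holomorphic_vec_on (f \<circ> inv_into U \<psi>) {y}"
proof -
  interpret complex_manifold M A by (rule X)
  obtain W where W: "openin M W" "p \<in> W" "holomorphic_vec_on (f \<circ> inv_into U \<psi>) (\<psi> ` (U \<inter> W))"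
    using f chart unfolding holomorphic_near_def by blast
  have "eventually (\<lambda>x. x \<in> W \<and> x \<in> U) (nhdsin M p)"
    unfolding eventually_nhdsin using W chart_dom[OF chart] p by (blast intro: openin_Int)
  then have "\<forall>\<^sub>F y in nhds (\<psi> p). inv_into U \<psi> y \<in> W \<and> inv_into U \<psi> y \<in> U"
    unfolding eventually_nhdsin_chart[OF X chart p] .
  moreover have "\<forall>\<^sub>F y in nhds (\<psi> p). y \<in> \<psi> ` U"
    using chart_img[OF chart] p by (intro eventually_nhds_in_open) auto
  ultimately show ?thesis
  proof eventually_elim
    case (elim y)
    then have "y \<in> \<psi> ` (U \<inter> W)" by (metis IntI f_inv_into_f image_eqI)
    then show ?case using W(3) unfolding holomorphic_vec_on_def by blast
  qed
qed

lemma holomorphic_germ_representative: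
  assumes "germ M p h \<in> holomorphic_germs M A p"
  obtains f where "holomorphic_near M A p f" "\<forall>\<^sub>F x in nhdsin M p. h x = f x"
  using assms unfolding holomorphic_germs_def by (auto simp: germ_eq_iff)

lemma holomorphic_germ_representatives:
  assumes "finite I" "\<And>i. i \<in> I \<Longrightarrow> germ M p (h i) \<in> holomorphic_germs M A p"
  obtains f where "\<And>i. i \<in> I \<Longrightarrow> holomorphic_near M A p (f i)"
    "\<forall>\<^sub>F x in nhdsin M p. \<forall>i\<in>I. h i x = f i x"
proof -
  have "\<forall>i\<in>I. \<exists>f. holomorphic_near M A p f \<and> (\<forall>\<^sub>F x in nhdsin M p. h i x = f x)"
    using assms(2) holomorphic_germ_representative by metis
  then obtain f where "\<forall>i\<in>I. holomorphic_near M A p (f i) \<and> (\<forall>\<^sub>F x in nhdsin M p. h i x = f i x)"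
    by (rule bchoice[THEN exE])
  then show ?thesis using that[of f] assms(1) by (simp add: eventually_ball_finite)
qed

lemma wedge_ring_representative:
  assumes "germ M p u \<in> wedge_ring M A p"
  obtains n r f where "\<And>i. i \<in> {1..n::nat} \<Longrightarrow> holomorphic_near M A p (f i)"
    "\<forall>\<^sub>F x in nhdsin M p. u x = hermitian_sum {1..n} r f x"
proof -
  obtain n r h where h: "\<forall>\<^sub>F x in nhdsin M p. u x = (\<Sum>i=1..n::nat. r i * (cmod (h i x))\<^sup>2)"
    "\<And>i. i \<in> {1..n} \<Longrightarrow> germ M p (h i) \<in> holomorphic_germs M A p"
    using assms unfolding wedge_ring_def by (auto simp: germ_eq_iff)
  obtain f where f: "\<And>i. i \<in> {1..n} \<Longrightarrow> holomorphic_near M A p (f i)"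
    "\<forall>\<^sub>F x in nhdsin M p. \<forall>i\<in>{1..n}. h i x = f i x"
    using holomorphic_germ_representatives[of "{1..n}" M p h A] h(2) by blast
  have "\<forall>\<^sub>F x in nhdsin M p. u x = hermitian_sum {1..n} r f x"
    using h(1) f(2) by eventually_elim (simp add: hermitian_sum_def)
  then show ?thesis using that f(1) by blast
qed

lemma fraction_germ_representative:
  assumes "germ M p F \<in> fraction_germs M A p"
  obtains u v where "germ M p u \<in> wedge_ring M A p" "germ M p v \<in> wedge_ring M A p"
    "\<not> (\<forall>\<^sub>F x in nhdsin M p. v x = 0)" "\<forall>\<^sub>F x in nhdsin M p. v x * F x = u x"
proof -
  obtain F' u v where *: "germ M p F = germ M p F'" "germ M p u \<in> wedge_ring M A p"
    "germ M p v \<in> wedge_ring M A p" "germ M p v \<noteq> germ M p (\<lambda>_. 0)"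
    "germ M p (\<lambda>x. v x * F' x) = germ M p u"
    using assms unfolding fraction_germs_def by auto
  have "\<forall>\<^sub>F x in nhdsin M p. F x = F' x" "\<forall>\<^sub>F x in nhdsin M p. v x * F' x = u x"
    using *(1,5) by (auto simp: germ_eq_iff)
  then have "\<forall>\<^sub>F x in nhdsin M p. v x * F x = u x" by eventually_elim simp
  then show ?thesis using that * by (auto simp: germ_eq_iff)
qed

text \<open>All data are carried to one coordinate ball. Nonconstancy of the germ provides a nonzero
  Hermitian sum: if that sum vanished near \<open>p\<close>, the germ would be the constant
  \<open>E 0\<close>.\<close>

lemma germ_kernel_constants:
  fixes M :: "'a topology" and A :: "('a set \<times> ('a \<Rightarrow> complex ^ 'n)) set" and I :: "'i set"
    and \<E> :: "complex \<Rightarrow> complex" and E :: "real \<Rightarrow> real"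
  assumes X: "complex_manifold M A" and p: "p \<in> topspace M" and I: "finite I"
    and h: "\<And>i. i \<in> I \<Longrightarrow> germ M p (h i) \<in> holomorphic_germs M A p"
    and zero: "\<And>i. i \<in> I \<Longrightarrow> h i p = 0"
    and \<E>: "\<E> holomorphic_on ball 0 1" "\<And>x. norm x < 1 \<Longrightarrow> (a + b * x) * deriv \<E> x = c + d * \<E> x"
    and E: "\<And>x. \<bar>x\<bar> < 1 \<Longrightarrow> \<E> (of_real x) = of_real (E x)" "\<And>x. \<bar>x\<bar> < 1 \<Longrightarrow> x \<noteq> 0 \<Longrightarrow> E x \<noteq> 0"
    and germ: "germ M p (\<lambda>x. E (hermitian_sum I r h x)) \<in> fraction_germs M A p - constant_germs M p"
  shows "\<not> (a = 1 \<and> b = 0 \<and> c = 0 \<and> d = 1)"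
    and "a = 1 \<Longrightarrow> b = 1 \<Longrightarrow> d = 0 \<Longrightarrow> c = 0"
    and "a = 1 \<Longrightarrow> b = 1 \<Longrightarrow> c = 0 \<Longrightarrow> d \<in> \<rat>"
proof -
  interpret complex_manifold M A by (rule X)
  obtain U \<psi> where chart: "(U, \<psi>) \<in> A" and pU: "p \<in> U" using cover p by blast
  define \<iota> where "\<iota> = inv_into U \<psi>"
  define x where "x = \<psi> p"
  note ev = eventually_nhdsin_chart[OF X chart pU, folded \<iota>_def x_def]
  have "inj_on \<psi> U"
    using chart_homeo[OF chart] openin_subset[OF chart_dom[OF chart]]
    unfolding homeomorphic_eq_everything_map by (simp add: inf.absorb2)
  then have \<iota>x: "\<iota> x = p" using pU by (simp add: \<iota>_def x_def)
  obtain u v where u: "germ M p u \<in> wedge_ring M A p" and v: "germ M p v \<in> wedge_ring M A p"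
    and vnz: "\<not> (\<forall>\<^sub>F x in nhdsin M p. v x = 0)"
    and vu: "\<forall>\<^sub>F x in nhdsin M p. v x * E (hermitian_sum I r h x) = u x"
    by (rule fraction_germ_representative[OF DiffD1[OF germ]]) (rule that; assumption)
  obtain m P g where g: "\<And>i. i \<in> {1..m::nat} \<Longrightarrow> holomorphic_near M A p (g i)"
    "\<forall>\<^sub>F x in nhdsin M p. v x = hermitian_sum {1..m} P g x"
    by (rule wedge_ring_representative[OF v]) (rule that; assumption)
  obtain n Q f where f: "\<And>i. i \<in> {1..n::nat} \<Longrightarrow> holomorphic_near M A p (f i)"
    "\<forall>\<^sub>F x in nhdsin M p. u x = hermitian_sum {1..n} Q f x"
    by (rule wedge_ring_representative[OF u]) (rule that; assumption)
  obtain k where k: "\<And>i. i \<in> I \<Longrightarrow> holomorphic_near M A p (k i)"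
    "\<forall>\<^sub>F x in nhdsin M p. \<forall>i\<in>I. h i x = k i x"
    by (rule holomorphic_germ_representatives[of I M p h A], rule I, erule h) (rule that; assumption)
  have eq: "\<forall>\<^sub>F y in nhds x. hermitian_sum {1..m} P g (\<iota> y) * E (hermitian_sum I r k (\<iota> y))
      = hermitian_sum {1..n} Q f (\<iota> y)"
  proof -
    have "\<forall>\<^sub>F x in nhdsin M p. hermitian_sum {1..m} P g x * E (hermitian_sum I r k x)
        = hermitian_sum {1..n} Q f x"
      using vu g(2) f(2) k(2)
    proof eventually_elim
      case (elim x)
      then have "hermitian_sum I r h x = hermitian_sum I r k x" by (simp add: hermitian_sum_def)
      then show ?case using elim by simp
    qed
    then show ?thesis unfolding ev .
  qed
  have vnz': "\<not> (\<forall>\<^sub>F y in nhds x. hermitian_sum {1..m} P g (\<iota> y) = 0)"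
  proof
    assume "\<forall>\<^sub>F y in nhds x. hermitian_sum {1..m} P g (\<iota> y) = 0"
    then have "\<forall>\<^sub>F x in nhdsin M p. hermitian_sum {1..m} P g x = 0" unfolding ev .
    with g(2) have "\<forall>\<^sub>F x in nhdsin M p. v x = 0" by eventually_elim simp
    then show False using vnz by blast
  qed
  have hnz: "\<not> (\<forall>\<^sub>F y in nhds x. hermitian_sum I r k (\<iota> y) = 0)"
  proof
    assume "\<forall>\<^sub>F y in nhds x. hermitian_sum I r k (\<iota> y) = 0"
    then have "\<forall>\<^sub>F x in nhdsin M p. hermitian_sum I r k x = 0" unfolding ev .
    with k(2) have "\<forall>\<^sub>F x in nhdsin M p. E (hermitian_sum I r h x) = E 0"
      by eventually_elim (simp add: hermitian_sum_def)
    then have "germ M p (\<lambda>x. E (hermitian_sum I r h x)) = germ M p (\<lambda>_. E 0)"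
      by (simp add: germ_eq_iff)
    then show False using germ unfolding constant_germs_def by blast
  qed
  \<comment> \<open>Agreement near a point includes the point itself, so the representatives inherit
    the zero at \<open>p\<close>.\<close>
  have kx: "k i (\<iota> x) = 0" if "i \<in> I" for i
  proof -
    have "\<forall>\<^sub>F y in nhds x. \<forall>i\<in>I. h i (\<iota> y) = k i (\<iota> y)" using k(2) unfolding ev .
    then have "\<forall>i\<in>I. h i (\<iota> x) = k i (\<iota> x)" by (rule eventually_nhds_x_imp_x)
    then show ?thesis using zero that by (simp add: \<iota>x)
  qed
  note near = holomorphic_near_chart[OF X chart pU, folded \<iota>_def x_def]
  define S where "S = (\<Sum>i\<in>I. \<bar>r i\<bar>)"
  \<comment> \<open>This gives \<open>S * B\<^sup>2 = S / (S + 1)\<^sup>2 < 1\<close>, and the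
    \<open>k i\<close>, vanishing at \<open>p\<close>, are bounded by \<open>B\<close> near
    it.\<close>
  define B where "B = 1 / (S + 1)"
  have "S \<ge> 0" by (simp add: S_def sum_nonneg)
  then have B: "B > 0" by (simp add: B_def)
  have "S < (S + 1)\<^sup>2" using \<open>S \<ge> 0\<close> by (simp add: power2_eq_square algebra_simps add_pos_nonneg)
  then have SB: "S * B\<^sup>2 < 1" using \<open>S \<ge> 0\<close> by (simp add: B_def power_divide divide_less_eq)
  have bound: "\<forall>\<^sub>F y in nhds x. \<forall>i\<in>I. norm (k i (\<iota> y)) \<le> B"
  proof (rule eventually_ball_finite[OF I], rule ballI)
    fix i assume i: "i \<in> I"
    have "holomorphic_vec_on (k i \<circ> \<iota>) {x}" using near[OF k(1)[OF i]] by (rule eventually_nhds_x_imp_x)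
    then have "isCont (k i \<circ> \<iota>) x"
      unfolding holomorphic_vec_on_def using has_derivative_continuous by blast
    then have "((k i \<circ> \<iota>) \<longlongrightarrow> 0) (nhds x)"
      using kx[OF i] unfolding isCont_def tendsto_at_iff_tendsto_nhds by simp
    then have "\<forall>\<^sub>F y in nhds x. dist ((k i \<circ> \<iota>) y) 0 < B" using B by (rule tendstoD)
    then show "\<forall>\<^sub>F y in nhds x. norm (k i (\<iota> y)) \<le> B" by (rule eventually_mono) simp
  qed
  have "\<forall>\<^sub>F y in nhds x. (\<forall>i\<in>I. norm (k i (\<iota> y)) \<le> B)
      \<and> (\<forall>i\<in>I. holomorphic_vec_on (k i \<circ> \<iota>) {y}) \<and> (\<forall>i\<in>{1..m}. holomorphic_vec_on (g i \<circ> \<iota>) {y})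
      \<and> (\<forall>i\<in>{1..n}. holomorphic_vec_on (f i \<circ> \<iota>) {y})
      \<and> hermitian_sum {1..m} P g (\<iota> y) * E (hermitian_sum I r k (\<iota> y)) = hermitian_sum {1..n} Q f (\<iota> y)"
    using I k(1) g(1) f(1)
    by (intro eventually_conj bound eq eventually_ball_finite ballI near) auto
  then obtain \<epsilon> where \<epsilon>: "\<epsilon> > 0" "\<And>y. dist y x < \<epsilon> \<Longrightarrow> (\<forall>i\<in>I. norm (k i (\<iota> y)) \<le> B)
      \<and> (\<forall>i\<in>I. holomorphic_vec_on (k i \<circ> \<iota>) {y}) \<and> (\<forall>i\<in>{1..m}. holomorphic_vec_on (g i \<circ> \<iota>) {y})
      \<and> (\<forall>i\<in>{1..n}. holomorphic_vec_on (f i \<circ> \<iota>) {y})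
      \<and> hermitian_sum {1..m} P g (\<iota> y) * E (hermitian_sum I r k (\<iota> y)) = hermitian_sum {1..n} Q f (\<iota> y)"
    unfolding eventually_nhds_metric by blast
  have comp: "hermitian_sum T t (\<lambda>i. l i \<circ> \<iota>) y = hermitian_sum T t l (\<iota> y)"
    for T t y and l :: "'s \<Rightarrow> 'a \<Rightarrow> complex" by (simp add: hermitian_sum_def)
  have hol: "\<And>i. i \<in> I \<Longrightarrow> holomorphic_vec_on (k i \<circ> \<iota>) (ball x \<epsilon>)"
    "\<And>i. i \<in> {1..m} \<Longrightarrow> holomorphic_vec_on (g i \<circ> \<iota>) (ball x \<epsilon>)"
    "\<And>i. i \<in> {1..n} \<Longrightarrow> holomorphic_vec_on (f i \<circ> \<iota>) (ball x \<epsilon>)"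
    using \<epsilon>(2) unfolding holomorphic_vec_on_def by (auto simp: dist_commute)
  have zero': "(k i \<circ> \<iota>) x = 0" if "i \<in> I" for i using kx[OF that] by simp
  have bound': "norm ((k i \<circ> \<iota>) y) \<le> B" if "i \<in> I" "y \<in> ball x \<epsilon>" for i y
    using \<epsilon>(2)[of y] that by (auto simp: dist_commute)
  have eq': "hermitian_sum {1..m} P (\<lambda>i. g i \<circ> \<iota>) y * E (hermitian_sum I r (\<lambda>i. k i \<circ> \<iota>) y)
      = hermitian_sum {1..n} Q (\<lambda>i. f i \<circ> \<iota>) y" if "y \<in> ball x \<epsilon>" for y
    unfolding comp using \<epsilon>(2)[of y] that by (auto simp: dist_commute)
  note kc = vector_kernel_constants[OF I finite_atLeastAtMost finite_atLeastAtMost \<epsilon>(1) hol zero' bound'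
      SB[unfolded S_def] \<E> E eq' vnz'[folded comp] hnz[folded comp]]
  show "\<not> (a = 1 \<and> b = 0 \<and> c = 0 \<and> d = 1)" using kc(1) by blast
  show "a = 1 \<Longrightarrow> b = 1 \<Longrightarrow> d = 0 \<Longrightarrow> c = 0" using kc(2) by blast
  show "a = 1 \<Longrightarrow> b = 1 \<Longrightarrow> c = 0 \<Longrightarrow> d \<in> \<rat>" using kc(3) by blast
qed

section \<open>The logarithm, the exponential and the powers\<close>

lemma one_plus_not_nonpos: "norm (x::complex) < 1 \<Longrightarrow> 1 + x \<notin> \<real>\<^sub>\<le>\<^sub>0"
proof
  assume x: "norm x < 1" and "1 + x \<in> \<real>\<^sub>\<le>\<^sub>0"
  then have "Re x \<le> -1" by (simp add: complex_nonpos_Reals_iff)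
  then show False using x abs_Re_le_cmod[of x] by linarith
qed

theorem theorem2p1:
  fixes M :: "'a topology" and A :: "('a set \<times> ('a \<Rightarrow> complex ^ 'n)) set" and p :: 'a
    and s :: nat and h :: "nat \<Rightarrow> 'a \<Rightarrow> complex" and r :: "nat \<Rightarrow> real"
  assumes "complex_manifold M A"
    and "p \<in> topspace M"
    and "s \<ge> 1"
    and "\<And>i. i \<in> {1..s} \<Longrightarrow> germ M p (h i) \<in> holomorphic_germs M A p"
    and "\<And>i. i \<in> {1..s} \<Longrightarrow> germ M p (h i) \<notin> constant_germs M p"
    and "\<And>i. i \<in> {1..s} \<Longrightarrow> h i p = 0"
    and "\<And>i. i \<in> {1..s} \<Longrightarrow> r i \<noteq> 0"
  shows "germ M p (\<lambda>x. ln (1 + (\<Sum>i=1..s. r i * (cmod (h i x))\<^sup>2)))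
           \<notin> fraction_germs M A p - constant_germs M p
       \<and> germ M p (\<lambda>x. exp (\<Sum>i=1..s. r i * (cmod (h i x))\<^sup>2))
           \<notin> fraction_germs M A p - constant_germs M p
       \<and> (\<forall>\<alpha>::real.
           germ M p (\<lambda>x. (1 + (\<Sum>i=1..s. r i * (cmod (h i x))\<^sup>2)) powr \<alpha>)
             \<in> fraction_germs M A p - constant_germs M p \<longrightarrow> \<alpha> \<in> \<rat>)"
proof -
  note gkc = germ_kernel_constants[where h = h and r = r, OF assms(1,2) finite_atLeastAtMost[of 1 s] assms(4,6),
      unfolded hermitian_sum_def]
  have nonzero: "1 + x \<noteq> 0" if "norm x < 1" for x :: complex
    using one_plus_not_nonpos[OF that] by auto
  have dln: "((\<lambda>x. Ln (1 + x)) has_field_derivative inverse (1 + x)) (at x)" if "norm x < 1" for x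
    using one_plus_not_nonpos[OF that] by (auto intro!: derivative_eq_intros)
  have hol_ln: "(\<lambda>x. Ln (1 + x)) holomorphic_on ball 0 1"
    by (intro holomorphic_intros one_plus_not_nonpos) auto
  have ln: "Ln (1 + of_real x) = of_real (ln (1 + x))" if "\<bar>x\<bar> < 1" for x
    using that Ln_of_real[of "1 + x"] by simp
  have "germ M p (\<lambda>x. ln (1 + (\<Sum>i=1..s. r i * (cmod (h i x))\<^sup>2)))
      \<notin> fraction_germs M A p - constant_germs M p" (is "?G \<notin> _")
  proof
    assume G: "?G \<in> fraction_germs M A p - constant_germs M p"
    \<comment> \<open>From \<open>(1 + x) * deriv \<E> x = 1\<close> the constants are
      \<open>c = 1\<close> and \<open>d = 0\<close>, so the conclusion \<open>c = 0\<close> is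
      absurd.\<close>
    have "(1::complex) = 0"
    proof (rule gkc(2)[where \<E> = "\<lambda>x. Ln (1 + x)" and a = 1 and b = 1 and c = 1 and d = 0
          and E = "\<lambda>x. ln (1 + x)"])
      show "(1 + 1 * x) * deriv (\<lambda>x. Ln (1 + x)) x = 1 + 0 * Ln (1 + x)" if "norm x < 1" for x
        using DERIV_imp_deriv[OF dln[OF that]] nonzero[OF that] by simp
      show "ln (1 + x) \<noteq> 0" if "\<bar>x\<bar> < 1" "x \<noteq> 0" for x :: real
        using that by simp
    qed (use G hol_ln ln in auto)
    then show False by simp
  qed
  moreover have "germ M p (\<lambda>x. exp (\<Sum>i=1..s. r i * (cmod (h i x))\<^sup>2))
      \<notin> fraction_germs M A p - constant_germs M p" (is "?G \<notin> _")
  proof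
    assume G: "?G \<in> fraction_germs M A p - constant_germs M p"
    have "\<not> ((1::complex) = 1 \<and> (0::complex) = 0 \<and> (0::complex) = 0 \<and> (1::complex) = 1)"
    proof (rule gkc(1)[where \<E> = exp and a = 1 and b = 0 and c = 0 and d = 1 and E = exp])
      show "(1 + 0 * x) * deriv exp x = 0 + 1 * exp x" for x :: complex
        using DERIV_imp_deriv[OF DERIV_exp] by simp
    qed (use G in \<open>auto intro: holomorphic_intros simp: exp_of_real\<close>)
    then show False by simp
  qed
  moreover have "\<alpha> \<in> \<rat>"
    if G: "germ M p (\<lambda>x. (1 + (\<Sum>i=1..s. r i * (cmod (h i x))\<^sup>2)) powr \<alpha>)
      \<in> fraction_germs M A p - constant_germs M p" for \<alpha> :: real
  proof -
    \<comment> \<open>The extension through the principal branch satisfies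
      \<open>(1 + x) * deriv \<E> x = \<alpha> * \<E> x\<close>, so \<open>d\<close> is the
      exponent.\<close>
    have "(of_real \<alpha> :: complex) \<in> \<rat>"
    proof (rule gkc(3)[where \<E> = "\<lambda>x. exp (of_real \<alpha> * Ln (1 + x))" and a = 1 and b = 1 and c = 0
          and d = "of_real \<alpha>" and E = "\<lambda>x. (1 + x) powr \<alpha>"])
      show "(\<lambda>x. exp (of_real \<alpha> * Ln (1 + x))) holomorphic_on ball 0 1"
        by (intro holomorphic_intros hol_ln)
      show "(1 + 1 * x) * deriv (\<lambda>x. exp (of_real \<alpha> * Ln (1 + x))) x =
          0 + of_real \<alpha> * exp (of_real \<alpha> * Ln (1 + x))" if "norm x < 1" for x
      proof -
        have "((\<lambda>x. exp (of_real \<alpha> * Ln (1 + x))) has_field_derivative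
            exp (of_real \<alpha> * Ln (1 + x)) * (of_real \<alpha> * inverse (1 + x))) (at x)"
          by (rule DERIV_chain2[OF DERIV_exp DERIV_cmult[OF dln[OF that]]])
        from DERIV_imp_deriv[OF this] show ?thesis using nonzero[OF that] by simp
      qed
      show "exp (of_real \<alpha> * Ln (1 + of_real x)) = of_real ((1 + x) powr \<alpha>)" if "\<bar>x\<bar> < 1" for x
        unfolding ln[OF that] powr_def using that
        by (auto simp: exp_of_real simp flip: of_real_mult)
    qed (use G in auto)
    then show ?thesis by simp
  qed
  ultimately show ?thesis by blast
qed

end
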